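(* Let $\lambda$ be a partition with $d=\ell(\lambda)$ parts and $\mu$ a partition with $[\mu]\subseteq[\lambda]$. Then $$\frac{\mathrm{rpp}_{\lambda/\mu}(q)}{\mathrm{rpp}_{\lambda}(q)}=\sum_{T\in\mathrm{SSYT}(\mu,d)}q^{p(T)}\prod_{u\in[\mu]}\bigl(1-q^{w(u,T(u))}\bigr),$$ where $$p(T)=\sum_{\substack{u\in[\mu]\\ m_T(u)\le k<T(u)}}w(u,k)$$ and $m_T(u)$ is the minimum $k\le T(u)$ such that replacing the entry $T(u)$ by $k$ still gives a semistandard tableau.
   Context: For $u=(i,j)$, $c(u)=j-i$ is the content, and $w(u,k)=\lambda_{d+1-k}-c(u)$. $\mathrm{SSYT}(\mu,d)$ is the set of semistandard Young tableaux of shape $\mu$ (positive integer entries, rows weakly and columns strictly increasing) with entries at most $d$. A reverse plane partition of a skew shape $\theta$ is a filling of the cells of $[\theta]$ with nonnegative integers, weakly increasing along rows (left to right) and down columns; $\mathrm{rpp}_\theta(q)=\sum_T q^{|T|}$ over all reverse plane partitions $T$ of shape $\theta$, where $|T|$ is the sum of the entries. *)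

theory Defs
  imports "HOL-Computational_Algebra.Formal_Laurent_Series" "HOL-Library.FuncSet"
begin

definition is_partition :: "nat list \<Rightarrow> bool" where
  "is_partition lam \<longleftrightarrow> sorted_wrt (\<ge>) lam \<and> (\<forall>x\<in>set lam. x > 0)"

(* Parts are numbered from 1, whereas list positions are numbered from 0. *)
definition part :: "nat list \<Rightarrow> nat \<Rightarrow> nat" where
  "part lam i = (if 1 \<le> i \<and> i \<le> length lam then lam ! (i - 1) else 0)"

type_synonym cell = "nat \<times> nat"

(* A cell (i, j) is in row i and column j, both numbered from 1; rows go downwards. *)
definition diagram :: "nat list \<Rightarrow> cell set" where
  "diagram lam = {(i, j). 1 \<le> i \<and> i \<le> length lam \<and> 1 \<le> j \<and> j \<le> part lam i}"

definition cell_content :: "cell \<Rightarrow> int" where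
  "cell_content u = int (snd u) - int (fst u)"

(* Fillings of a set of cells are extensional functions, so that distinct functions are
   distinct fillings. *)
definition is_rpp :: "cell set \<Rightarrow> (cell \<Rightarrow> nat) \<Rightarrow> bool" where
  "is_rpp \<theta> T \<longleftrightarrow> T \<in> extensional \<theta> \<and>
     (\<forall>i j j'. (i, j) \<in> \<theta> \<longrightarrow> (i, j') \<in> \<theta> \<longrightarrow> j < j' \<longrightarrow> T (i, j) \<le> T (i, j')) \<and>
     (\<forall>i i' j. (i, j) \<in> \<theta> \<longrightarrow> (i', j) \<in> \<theta> \<longrightarrow> i < i' \<longrightarrow> T (i, j) \<le> T (i', j))"

(* The sum of q^|T| over all reverse plane partitions T, collected by powers of q:
   the coefficient of q^n is the number of T with |T| = n (see finite_rpp_of_size). *)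
definition rpp :: "cell set \<Rightarrow> rat fps" where
  "rpp \<theta> = Abs_fps (\<lambda>n. of_nat (card {T. is_rpp \<theta> T \<and> (\<Sum>u\<in>\<theta>. T u) = n}))"

definition is_ssyt :: "nat list \<Rightarrow> (cell \<Rightarrow> nat) \<Rightarrow> bool" where
  "is_ssyt \<mu> T \<longleftrightarrow> T \<in> extensional (diagram \<mu>) \<and>
     (\<forall>u\<in>diagram \<mu>. T u \<ge> 1) \<and>
     (\<forall>i j j'. (i, j) \<in> diagram \<mu> \<longrightarrow> (i, j') \<in> diagram \<mu> \<longrightarrow> j < j' \<longrightarrow> T (i, j) \<le> T (i, j')) \<and>
     (\<forall>i i' j. (i, j) \<in> diagram \<mu> \<longrightarrow> (i', j) \<in> diagram \<mu> \<longrightarrow> i < i' \<longrightarrow> T (i, j) < T (i', j))"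

definition SSYT :: "nat list \<Rightarrow> nat \<Rightarrow> (cell \<Rightarrow> nat) set" where
  "SSYT \<mu> d = {T. is_ssyt \<mu> T \<and> (\<forall>u\<in>diagram \<mu>. T u \<le> d)}"

(* w(u, k), with d the number of parts of lam; it is meant for 1 \<le> k \<le> d.
   Its values can be negative. *)
definition weight :: "nat list \<Rightarrow> cell \<Rightarrow> nat \<Rightarrow> int" where
  "weight lam u k = int (part lam (length lam + 1 - k)) - cell_content u"

definition min_entry :: "nat list \<Rightarrow> (cell \<Rightarrow> nat) \<Rightarrow> cell \<Rightarrow> nat" where
  "min_entry \<mu> T u = (LEAST k. k \<le> T u \<and> is_ssyt \<mu> (T(u := k)))"

definition p_stat :: "nat list \<Rightarrow> nat list \<Rightarrow> (cell \<Rightarrow> nat) \<Rightarrow> int" where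
  "p_stat lam \<mu> T = (\<Sum>u\<in>diagram \<mu>. \<Sum>k\<in>{min_entry \<mu> T u..<T u}. weight lam u k)"

lemma finite_diagram: "finite (diagram lam)"
proof (rule finite_subset)
  show "diagram lam \<subseteq> (\<Union>i\<in>{..length lam}. {i} \<times> {..part lam i})"
    by (auto simp: diagram_def)
qed auto

lemma finite_rpp_of_size:
  assumes "finite \<theta>"
  shows "finite {T. is_rpp \<theta> T \<and> (\<Sum>u\<in>\<theta>. T u) = n}"
proof (rule finite_subset)
  show "{T. is_rpp \<theta> T \<and> (\<Sum>u\<in>\<theta>. T u) = n} \<subseteq> (\<Pi>\<^sub>E u\<in>\<theta>. {..n})"
    using assms by (auto simp: is_rpp_def PiE_def intro: member_le_sum)
  show "finite (\<Pi>\<^sub>E u\<in>\<theta>. {..n})"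
    using assms by (intro finite_PiE) auto
qed

lemma finite_SSYT: "finite (SSYT \<mu> d)"
proof (rule finite_subset)
  show "SSYT \<mu> d \<subseteq> (\<Pi>\<^sub>E u\<in>diagram \<mu>. {..d})"
    by (auto simp: SSYT_def is_ssyt_def PiE_def)
  show "finite (\<Pi>\<^sub>E u\<in>diagram \<mu>. {..d})"
    using finite_diagram by (intro finite_PiE) auto
qed

end

theory Submission
  imports Defs
begin

text \<open>
  Write \<open>L\<close> for the partition \<open>lam\<close>, put \<open>r = 1/q\<close> and give the letter \<open>k\<close> the variable
  \<open>x\<^sub>k = q^(lam\<^sub>d\<^sub>+\<^sub>1\<^sub>-\<^sub>k)\<close>. Then \<open>q^w(u,k) = x\<^sub>k q^i r^j\<close> for \<open>u = (i,j)\<close>, so the right-hand side of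
  the theorem is a sum \<open>S(\<mu>)\<close> over tableaux with a weight that is a product over the cells (it is a
  factorial Grothendieck polynomial in the \<open>x\<^sub>k\<close>). The proof shows that, as functions of \<open>\<mu>\<close>, both
  \<open>S(\<mu>)\<close> and \<open>rpp(L/\<mu>)\<close> satisfy the linear system
  \[ r^{|L|} F(\mu) = \sum_{\mu \subseteq \kappa \subseteq L} r^{|\kappa|} F(\kappa). \]
  The coefficient of \<open>F(\<mu>)\<close> itself is \<open>r^|L| - r^|\<mu>|\<close>, which is nonzero unless \<open>\<mu> = L\<close>, so
  the solution is unique up to a scalar (\<open>inversion_unique\<close>). The scalar is found at the empty
  partition, where \<open>S = 1\<close>; hence \<open>S(\<mu>) = rpp(L/\<mu>) / rpp(L)\<close>.

  For reverse plane partitions the system is immediate: the zero entries together with \<open>\<mu>\<close> form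
  a partition \<open>\<kappa>\<close>, and subtracting 1 from the remaining entries leaves an arbitrary reverse plane
  partition of \<open>L/\<kappa>\<close> (\<open>rpp_by_zero_set\<close>).

  For tableaux the system (\<open>inversion\<close>) is proved by induction on the number of letters, which at the
  same time removes the first row of \<open>L\<close>. It rests on three facts.

  First, the cell weights behave like probabilities. Fill a cell whose neighbours force its entry to
  be at least \<open>m\<close> by going through \<open>k = m, m + 1, \<dots>, d\<close> and stopping at \<open>k\<close> with probability
  \<open>1 - q^w(u,k)\<close>; if no letter is chosen, the entry is infinite. The weights of all choices sum to 1,
  so the total weight of the fillings that are finite on a given shape does not depend on how far
  the filling is continued outside that shape (\<open>sum_capped_eq_ssyt_sum\<close>).

  Secondly, reading the infinite cells as the letter \<open>d + 1\<close> gives the branching rule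
  (\<open>branching\<close>): \<open>S\<close> with \<open>d + 1\<close> letters is a sum over the partitions that interlace with \<open>\<mu>\<close> of
  \<open>S\<close> with \<open>d\<close> letters, and the coefficients are products over the rows.

  Thirdly, after the branching rule and the induction hypothesis are inserted, the coefficients to
  compare again factor over the rows, because the parts of interlacing partitions range over
  independent intervals. Each factor is a telescoping sum (\<open>row_sum\<close>, \<open>inversion_coefficient\<close>). The
  summands with \<open>\<kappa>\<close> outside \<open>L\<close> drop out since \<open>S\<close> vanishes there (\<open>ssyt_sum_vanishes\<close>).
\<close>

section \<open>Partitions as row-length functions\<close>

text \<open>Inside the proof a partition is a weakly decreasing, eventually zero function on row numbers
  that start at 0, whereas cells keep their coordinates from 1. The number of rows is thereby free to
  vary in an induction.\<close>
definition young :: "(nat \<Rightarrow> nat) \<Rightarrow> cell set" where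
  "young f = {(i, j). 1 \<le> i \<and> 1 \<le> j \<and> j \<le> f (i - 1)}"

definition down_closed :: "cell set \<Rightarrow> bool" where
  "down_closed D \<longleftrightarrow> (\<forall>i j. (i, j) \<in> D \<longrightarrow> 1 \<le> i \<and> 1 \<le> j \<and>
     (\<forall>i' j'. 1 \<le> i' \<and> i' \<le> i \<and> 1 \<le> j' \<and> j' \<le> j \<longrightarrow> (i', j') \<in> D))"

lemma down_closedD:
  assumes "down_closed D" "(i, j) \<in> D" "1 \<le> i'" "i' \<le> i" "1 \<le> j'" "j' \<le> j"
  shows "(i', j') \<in> D"
  using assms unfolding down_closed_def by blast

lemma down_closed_pos:
  assumes "down_closed D" "(i, j) \<in> D"
  shows "1 \<le> i" "1 \<le> j"
  using assms unfolding down_closed_def by blast+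

lemma mem_young_Suc [simp]: "(Suc i, j) \<in> young f \<longleftrightarrow> 1 \<le> j \<and> j \<le> f i"
  by (auto simp: young_def)

lemma young_mono_iff: "young f \<subseteq> young g \<longleftrightarrow> f \<le> g"
proof
  assume sub: "young f \<subseteq> young g"
  show "f \<le> g"
  proof (rule le_funI)
    fix i
    show "f i \<le> g i"
    proof (cases "f i")
      case (Suc n)
      then have "(Suc i, f i) \<in> young f" by simp
      then have "(Suc i, f i) \<in> young g" using sub by blast
      then show ?thesis by simp
    qed simp
  qed
next
  assume "f \<le> g"
  then show "young f \<subseteq> young g"
    unfolding young_def le_fun_def by (auto intro: order_trans[of _ "f _" "g _"])
qed

lemma young_inject: "young f = young g \<longleftrightarrow> f = g"
  using young_mono_iff[of f g] young_mono_iff[of g f] by auto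

lemma down_closed_young: "antimono f \<Longrightarrow> down_closed (young f)"
proof -
  assume f: "antimono f"
  have "j' \<le> f (i' - 1)" if "j \<le> f (i - 1)" "i' \<le> i" "j' \<le> j" for i j i' j'
    using antimonoD[OF f, of "i' - 1" "i - 1"] that by linarith
  then show ?thesis unfolding down_closed_def young_def by auto
qed

lemma young_eq_Sigma:
  assumes "\<forall>i\<ge>R. f i = 0"
  shows "young f = (\<lambda>(i, j). (Suc i, j)) ` (SIGMA i:{..<R}. {1..f i})"
proof -
  have "(i, j) \<in> (\<lambda>(i, j). (Suc i, j)) ` (SIGMA i:{..<R}. {1..f i})" if "(i, j) \<in> young f" for i j
  proof -
    have h: "1 \<le> i" "1 \<le> j" "j \<le> f (i - 1)" using that by (auto simp: young_def)
    then have "i - 1 < R" using assms by (cases "i - 1 < R") auto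
    then show ?thesis using h by (intro image_eqI[of _ _ "(i - 1, j)"]) auto
  qed
  moreover have "(\<lambda>(i, j). (Suc i, j)) ` (SIGMA i:{..<R}. {1..f i}) \<subseteq> young f"
    by (auto simp: young_def)
  ultimately show ?thesis by (intro equalityI subrelI) blast+
qed

lemma inj_on_Suc_row: "inj_on (\<lambda>(i, j). (Suc i, j)) A"
  by (auto simp: inj_on_def)

lemma finite_young:
  assumes "\<forall>i\<ge>R. f i = 0"
  shows "finite (young f)"
  unfolding young_eq_Sigma[OF assms] by (intro finite_imageI finite_SigmaI) auto

lemma card_young:
  assumes "\<forall>i\<ge>R. f i = 0"
  shows "card (young f) = (\<Sum>i<R. f i)"
  unfolding young_eq_Sigma[OF assms] card_image[OF inj_on_Suc_row] by simp

lemma prod_young: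
  fixes g :: "cell \<Rightarrow> 'b::comm_monoid_mult"
  assumes "\<forall>i\<ge>R. f i = 0"
  shows "(\<Prod>u\<in>young f. g u) = (\<Prod>i<R. \<Prod>j\<in>{1..f i}. g (Suc i, j))"
proof -
  have "(\<Prod>u\<in>young f. g u) = (\<Prod>p\<in>(SIGMA i:{..<R}. {1..f i}). g (case p of (i, j) \<Rightarrow> (Suc i, j)))"
    unfolding young_eq_Sigma[OF assms] prod.reindex[OF inj_on_Suc_row] by simp
  also have "\<dots> = (\<Prod>(i, j)\<in>(SIGMA i:{..<R}. {1..f i}). g (Suc i, j))"
    by (rule prod.cong) auto
  finally show ?thesis by (simp add: prod.Sigma)
qed

lemma initial_segment:
  fixes A :: "nat set"
  assumes "finite A" and "\<And>j. j \<in> A \<Longrightarrow> 1 \<le> j" and "\<And>j j'. j \<in> A \<Longrightarrow> 1 \<le> j' \<Longrightarrow> j' \<le> j \<Longrightarrow> j' \<in> A"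
  shows "A = {1..card A}"
proof (cases "A = {}")
  case False
  have "A = {1..Max A}"
  proof (intro equalityI subsetI)
    fix j assume "j \<in> A"
    then show "j \<in> {1..Max A}" using assms(2) Max_ge[OF assms(1)] by simp
  next
    fix j assume "j \<in> {1..Max A}"
    then show "j \<in> A" using assms(3)[OF Max_in[OF assms(1) False]] by simp
  qed
  then show ?thesis by (metis card_atLeastAtMost diff_Suc_1)
qed simp

lemma down_closed_eq_young:
  assumes "down_closed D" "finite D"
  obtains f where "antimono f" "D = young f"
proof -
  define row where "row i = {j. (Suc i, j) \<in> D}" for i
  define f where "f i = card (row i)" for i
  have fin: "finite (row i)" for i
    using finite_imageI[OF assms(2), of snd] by (rule rev_finite_subset) (force simp: row_def)
  have row: "row i = {1..f i}" for i
    unfolding f_def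
  proof (rule initial_segment[OF fin])
    fix j assume j: "j \<in> row i"
    then show "1 \<le> j" using down_closed_pos(2)[OF assms(1)] by (simp add: row_def)
    fix j' assume "1 \<le> j'" "j' \<le> j"
    then show "j' \<in> row i" using j down_closedD[OF assms(1), of "Suc i" j "Suc i" j'] by (simp add: row_def)
  qed
  have "antimono f"
  proof (rule antimonoI)
    fix i i' :: nat
    assume "i \<le> i'"
    then have "(Suc i, j) \<in> D" if "(Suc i', j) \<in> D" for j
      using down_closed_pos(2)[OF assms(1) that] by (intro down_closedD[OF assms(1) that]) auto
    then have "row i' \<subseteq> row i"
      unfolding row_def by blast
    then show "f i' \<le> f i" unfolding f_def by (rule card_mono[OF fin])
  qed
  moreover have "D = young f"
  proof -
    have "(i, j) \<in> D \<longleftrightarrow> (i, j) \<in> young f" for i j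
    proof (cases i)
      case 0
      then show ?thesis using down_closed_pos(1)[OF assms(1), of i j] by (auto simp: young_def)
    next
      case (Suc k)
      have "(i, j) \<in> D \<longleftrightarrow> j \<in> row k" by (simp add: row_def Suc)
      then show ?thesis by (simp add: row Suc)
    qed
    then show ?thesis by auto
  qed
  ultimately show thesis by (rule that)
qed

text \<open>The rows of an interlacing partition vary independently; \<open>rows\<close> is the corresponding box.
  Fixing the value 0 outside it, instead of the arbitrary value of extensional functions, makes its
  elements row-length functions.\<close>
definition rows :: "nat \<Rightarrow> (nat \<Rightarrow> nat set) \<Rightarrow> (nat \<Rightarrow> nat) set" where
  "rows R A = {f. (\<forall>i<R. f i \<in> A i) \<and> (\<forall>i\<ge>R. f i = 0)}"

lemma rows_PiE:
  "bij_betw (\<lambda>f i. if i < R then f i else 0) (PiE {..<R} A) (rows R A)"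
proof (rule bij_betw_byWitness[where f' = "\<lambda>f. restrict f {..<R}"])
  show "\<forall>f\<in>PiE {..<R} A. restrict (\<lambda>i. if i < R then f i else 0) {..<R} = f"
  proof (intro ballI ext)
    fix f i assume "f \<in> PiE {..<R} A"
    then show "restrict (\<lambda>i. if i < R then f i else 0) {..<R} i = f i"
      by (cases "i < R") (simp_all add: PiE_arb[of f])
  qed
  show "\<forall>f\<in>rows R A. (\<lambda>i. if i < R then restrict f {..<R} i else 0) = f"
  proof (intro ballI ext)
    fix f i assume "f \<in> rows R A"
    then show "(if i < R then restrict f {..<R} i else 0) = f i"
      by (cases "i < R") (simp_all add: rows_def)
  qed
  show "(\<lambda>f i. if i < R then f i else 0) ` PiE {..<R} A \<subseteq> rows R A"
  proof (rule image_subsetI)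
    fix f assume "f \<in> PiE {..<R} A"
    then show "(\<lambda>i. if i < R then f i else 0) \<in> rows R A"
      by (simp add: rows_def PiE_mem[of f])
  qed
  show "(\<lambda>f. restrict f {..<R}) ` rows R A \<subseteq> PiE {..<R} A"
  proof (rule image_subsetI)
    fix f assume "f \<in> rows R A"
    then show "restrict f {..<R} \<in> PiE {..<R} A"
      by (intro PiE_I) (simp_all add: rows_def)
  qed
qed

lemma finite_rows:
  assumes "\<And>i. i < R \<Longrightarrow> finite (A i)"
  shows "finite (rows R A)"
proof -
  have "finite (PiE {..<R} A)" using assms by (intro finite_PiE) simp_all
  then show ?thesis using bij_betw_finite[OF rows_PiE, of R A] by blast
qed

lemma sum_prod_rows:
  fixes g :: "nat \<Rightarrow> nat \<Rightarrow> 'b::comm_semiring_1"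
  assumes "\<And>i. i < R \<Longrightarrow> finite (A i)"
  shows "(\<Sum>f\<in>rows R A. \<Prod>i<R. g i (f i)) = (\<Prod>i<R. \<Sum>n\<in>A i. g i n)"
proof -
  have "(\<Sum>f\<in>rows R A. \<Prod>i<R. g i (f i)) = (\<Sum>f\<in>PiE {..<R} A. \<Prod>i<R. g i (f i))"
    using sum.reindex_bij_betw[OF rows_PiE, of "\<lambda>f. \<Prod>i<R. g i (f i)" R A] by simp
  also have "\<dots> = (\<Prod>i<R. \<Sum>n\<in>A i. g i n)"
    by (rule prod_sum_PiE[symmetric]) (simp_all add: assms)
  finally show ?thesis .
qed

definition between :: "(nat \<Rightarrow> nat) \<Rightarrow> (nat \<Rightarrow> nat) \<Rightarrow> (nat \<Rightarrow> nat) set" where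
  "between f L = {g. antimono g \<and> f \<le> g \<and> g \<le> L}"

lemma finite_between:
  assumes "\<forall>i\<ge>R. L i = 0"
  shows "finite (between f L)"
proof (rule finite_subset)
  show "between f L \<subseteq> rows R (\<lambda>i. {..L i})"
  proof
    fix g assume "g \<in> between f L"
    then have "g i \<le> L i" for i by (auto simp: between_def le_fun_def)
    then show "g \<in> rows R (\<lambda>i. {..L i})" using assms by (auto simp: rows_def) (metis le_zero_eq)
  qed
  show "finite (rows R (\<lambda>i. {..L i}))" by (rule finite_rows) simp
qed

section \<open>Tableaux and their weights\<close>

text \<open>The least value that the left and upper neighbours of a cell allow in it. In a tableau this
  is the \<open>m\<^sub>T(u)\<close> of the theorem, because lowering one entry cannot violate the conditions
  towards its right and lower neighbours.\<close>
definition low :: "(cell \<Rightarrow> nat) \<Rightarrow> cell \<Rightarrow> nat" where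
  "low T u = max (if 1 < snd u then T (fst u, snd u - 1) else 1)
                 (if 1 < fst u then Suc (T (fst u - 1, snd u)) else 1)"

definition tableaux :: "cell set \<Rightarrow> nat \<Rightarrow> (cell \<Rightarrow> nat) set" where
  "tableaux D d = {T \<in> extensional D. \<forall>u\<in>D. low T u \<le> T u \<and> T u \<le> d}"

text \<open>The fillings produced by the random process described above. The value \<open>d + 1\<close> encodes
  infinity, so it may be repeated down a column; the entries on \<open>E\<close> are required to be finite.\<close>
definition capped :: "cell set \<Rightarrow> cell set \<Rightarrow> nat \<Rightarrow> (cell \<Rightarrow> nat) set" where
  "capped E D d = {T \<in> extensional D. \<forall>u\<in>D. min (Suc d) (low T u) \<le> T u \<and> T u \<le> Suc d \<and> (u \<in> E \<longrightarrow> T u \<le> d)}"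

lemma finite_capped:
  assumes "finite D"
  shows "finite (capped E D d)"
proof (rule finite_subset)
  show "capped E D d \<subseteq> PiE D (\<lambda>_. {..Suc d})"
  proof
    fix T assume "T \<in> capped E D d"
    then show "T \<in> PiE D (\<lambda>_. {..Suc d})"
      by (intro PiE_I) (simp_all add: capped_def extensional_arb[of T D])
  qed
  show "finite (PiE D (\<lambda>_. {..Suc d}))" using assms by (intro finite_PiE) simp_all
qed

lemma capped_self: "capped D D d = tableaux D d"
proof -
  have "min (Suc d) (low T u) \<le> T u \<and> T u \<le> Suc d \<and> (u \<in> D \<longrightarrow> T u \<le> d) \<longleftrightarrow> low T u \<le> T u \<and> T u \<le> d"
    if "u \<in> D" for T u
    using that by (simp add: min_def) linarith
  then show ?thesis unfolding capped_def tableaux_def by blast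
qed

lemma low_pos: "1 \<le> low T u"
  by (auto simp: low_def max_def)

lemma low_upd_self: "1 \<le> fst u \<Longrightarrow> low (T(u := t)) u = low T u"
  by (cases u) (auto simp: low_def)

lemma low_upd_other:
  assumes "down_closed (D - {u})" "v \<in> D - {u}"
  shows "low (T(u := t)) v = low T v"
proof -
  obtain i j where v: "v = (i, j)" by (cases v)
  have ij: "(i, j) \<in> D - {u}" using assms(2) v by simp
  note pos = down_closed_pos[OF assms(1) ij]
  have "(i, j - 1) \<in> D - {u}" if "1 < j"
    using that pos by (intro down_closedD[OF assms(1) ij]) simp_all
  moreover have "(i - 1, j) \<in> D - {u}" if "1 < i"
    using that pos by (intro down_closedD[OF assms(1) ij]) simp_all
  ultimately have "1 < j \<Longrightarrow> (i, j - 1) \<noteq> u" "1 < i \<Longrightarrow> (i - 1, j) \<noteq> u" by blast+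
  then show ?thesis unfolding v low_def by simp
qed

text \<open>The total probability of the choices at one cell is 1. For \<open>m > d\<close> infinity is forced and
  the products are empty.\<close>
lemma telescoping_choice:
  fixes a :: "nat \<Rightarrow> 'b::comm_ring_1"
  shows "(\<Sum>t\<in>{min (Suc d) m..Suc d}. (\<Prod>k\<in>{m..<t}. a k) * (if t \<le> d then 1 - a t else 1)) = 1"
proof (cases "m \<le> d")
  case False
  then have "{min (Suc d) m..Suc d} = {Suc d}" by auto
  then show ?thesis using False by simp
next
  case True
  have tele: "(\<Sum>t\<in>{m..<n}. (\<Prod>k\<in>{m..<t}. a k) * (1 - a t)) = 1 - (\<Prod>k\<in>{m..<n}. a k)" if "m \<le> n" for n
    using that by (induction n rule: dec_induct) (auto simp: algebra_simps)
  have "{min (Suc d) m..Suc d} = insert (Suc d) {m..<Suc d}" using True by auto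
  then show ?thesis using tele[of "Suc d"] True by (simp add: if_distrib cong: if_cong)
qed

text \<open>Positive and negative powers of \<open>q\<close> are kept apart as powers of \<open>q\<close> and of \<open>r\<close>, so that all
  exponents are natural numbers.\<close>
locale content_weights =
  fixes q r :: "'a::field" and x :: "nat \<Rightarrow> 'a"
  assumes qr: "q * r = 1"
begin

definition letter_wt :: "cell \<Rightarrow> nat \<Rightarrow> 'a" where
  "letter_wt u k = x k * q ^ fst u * r ^ snd u"

definition cap_wt :: "nat \<Rightarrow> (cell \<Rightarrow> nat) \<Rightarrow> cell \<Rightarrow> 'a" where
  "cap_wt d T u = (\<Prod>k\<in>{low T u..<T u}. letter_wt u k) * (if T u \<le> d then 1 - letter_wt u (T u) else 1)"

text \<open>With \<open>low\<close> in the place of \<open>m\<^sub>T\<close> this is the right-hand side of the theorem.\<close>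
definition ssyt_sum :: "cell set \<Rightarrow> nat \<Rightarrow> 'a" where
  "ssyt_sum D d = (\<Sum>T\<in>tableaux D d. \<Prod>u\<in>D. (\<Prod>k\<in>{low T u..<T u}. letter_wt u k) * (1 - letter_wt u (T u)))"

text \<open>A maximal cell is filled last and no other cell depends on it, so summing over its entry gives
  the factor 1.\<close>
lemma sum_capped_remove:
  assumes "finite D" "down_closed D" "down_closed (D - {u})" "u \<in> D" "u \<notin> E"
  shows "(\<Sum>T\<in>capped E D d. \<Prod>v\<in>D. cap_wt d T v) =
    (\<Sum>T\<in>capped E (D - {u}) d. \<Prod>v\<in>D - {u}. cap_wt d T v)"
proof -
  let ?D = "D - {u}"
  have u1: "1 \<le> fst u" using down_closed_pos(1)[OF assms(2)] assms(4) by (cases u) auto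
  have lowu: "low (T(u := t)) u = low T u" for T t by (rule low_upd_self[OF u1])
  have lowo: "low (T(u := t)) v = low T v" if "v \<in> ?D" for T t v
    by (rule low_upd_other[OF assms(3) that])
  have wto: "cap_wt d (T(u := t)) v = cap_wt d T v" if "v \<in> ?D" for T t v
    using that by (auto simp: cap_wt_def lowo[OF that])
  have "(\<Sum>T\<in>capped E D d. \<Prod>v\<in>D. cap_wt d T v) =
      (\<Sum>(T, t)\<in>(SIGMA T:capped E ?D d. {min (Suc d) (low T u)..Suc d}). \<Prod>v\<in>D. cap_wt d (T(u := t)) v)"
  proof (rule sum.reindex_bij_witness[where i = "\<lambda>(T, t). T(u := t)" and j = "\<lambda>T. (T(u := undefined), T u)"])
    fix T assume T: "T \<in> capped E D d"
    show "(case (T(u := undefined), T u) of (T, t) \<Rightarrow> T(u := t)) = T" by simp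
    show "(T(u := undefined), T u) \<in> (SIGMA T:capped E ?D d. {min (Suc d) (low T u)..Suc d})"
      using T assms(4) by (auto simp: capped_def extensional_def lowu lowo)
    show "(case (T(u := undefined), T u) of (T, t) \<Rightarrow> \<Prod>v\<in>D. cap_wt d (T(u := t)) v) = (\<Prod>v\<in>D. cap_wt d T v)"
      by simp
  next
    fix p assume p: "p \<in> (SIGMA T:capped E ?D d. {min (Suc d) (low T u)..Suc d})"
    obtain T t where pt: "p = (T, t)" by (cases p)
    have T: "T \<in> capped E ?D d" "min (Suc d) (low T u) \<le> t" "t \<le> Suc d" using p pt by auto
    then have und: "T u = undefined" by (intro extensional_arb[of T ?D]) (simp_all add: capped_def)
    show "((case p of (T, t) \<Rightarrow> T(u := t))(u := undefined), (case p of (T, t) \<Rightarrow> T(u := t)) u) = p"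
      using und by (simp add: pt) (metis fun_upd_triv)
    have "min (Suc d) (low (T(u := t)) v) \<le> (T(u := t)) v \<and> (T(u := t)) v \<le> Suc d \<and> (v \<in> E \<longrightarrow> (T(u := t)) v \<le> d)"
      if "v \<in> D" for v
      using T that assms(5) lowo[of v T t] by (cases "v = u") (auto simp: capped_def lowu)
    then show "(case p of (T, t) \<Rightarrow> T(u := t)) \<in> capped E D d"
      using T assms(4) by (auto simp: pt capped_def extensional_def)
  qed
  also have "\<dots> = (\<Sum>T\<in>capped E ?D d. \<Sum>t\<in>{min (Suc d) (low T u)..Suc d}. \<Prod>v\<in>D. cap_wt d (T(u := t)) v)"
    using assms(1) by (subst sum.Sigma) (auto intro: finite_capped)
  also have "\<dots> = (\<Sum>T\<in>capped E ?D d. \<Prod>v\<in>?D. cap_wt d T v)"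
  proof (rule sum.cong[OF refl])
    fix T
    have "(\<Sum>t\<in>{min (Suc d) (low T u)..Suc d}. \<Prod>v\<in>D. cap_wt d (T(u := t)) v) =
      (\<Sum>t\<in>{min (Suc d) (low T u)..Suc d}. (\<Prod>v\<in>?D. cap_wt d T v) * cap_wt d (T(u := t)) u)"
      using assms(1,4) by (intro sum.cong refl) (simp add: prod.remove wto mult.commute)
    also have "\<dots> = (\<Prod>v\<in>?D. cap_wt d T v) * (\<Sum>t\<in>{min (Suc d) (low T u)..Suc d}. cap_wt d (T(u := t)) u)"
      by (rule sum_distrib_left[symmetric])
    also have "(\<Sum>t\<in>{min (Suc d) (low T u)..Suc d}. cap_wt d (T(u := t)) u) = 1"
      unfolding cap_wt_def lowu fun_upd_same by (rule telescoping_choice)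
    finally show "(\<Sum>t\<in>{min (Suc d) (low T u)..Suc d}. \<Prod>v\<in>D. cap_wt d (T(u := t)) v) = (\<Prod>v\<in>?D. cap_wt d T v)"
      unfolding mult_1_right .
  qed
  finally show ?thesis .
qed

text \<open>The cells outside \<open>E\<close> are peeled off one at a time, each time one that is maximal.\<close>
lemma sum_capped_eq_ssyt_sum:
  assumes "finite D" "down_closed D" "down_closed E" "E \<subseteq> D"
  shows "(\<Sum>T\<in>capped E D d. \<Prod>v\<in>D. cap_wt d T v) = ssyt_sum E d"
  using assms
proof (induction "card (D - E)" arbitrary: D)
  case 0
  then have "D = E" by auto
  then show ?case
    by (auto simp: capped_self ssyt_sum_def cap_wt_def tableaux_def intro!: sum.cong prod.cong)
next
  case (Suc n)
  have fin: "finite (D - E)" "D - E \<noteq> {}" using Suc by auto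
  define s where "s = Max ((\<lambda>u. fst u + snd u) ` (D - E))"
  obtain u where u: "u \<in> D - E" "fst u + snd u = s"
    using Max_in[of "(\<lambda>u. fst u + snd u) ` (D - E)"] fin unfolding s_def
    by (metis (no_types, lifting) finite_imageI image_iff image_is_empty)
  have mx: "fst v + snd v \<le> s" if "v \<in> D - E" for v
    using fin that unfolding s_def by (intro Max_ge) auto
  \<comment> \<open>A cell weakly to the lower right of \<open>u\<close> lies in \<open>E\<close> only if \<open>u\<close> does, and outside \<open>E\<close> it would
     have a larger coordinate sum.\<close>
  have dc: "down_closed (D - {u})"
    unfolding down_closed_def
  proof (intro allI impI conjI)
    fix i j assume ij: "(i, j) \<in> D - {u}"
    then show "1 \<le> i" "1 \<le> j" using down_closed_pos[OF Suc.prems(2)] by auto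
    fix i' j' assume le: "1 \<le> i' \<and> i' \<le> i \<and> 1 \<le> j' \<and> j' \<le> j"
    have "(i', j') \<noteq> u"
    proof
      assume eq: "(i', j') = u"
      have "(i, j) \<notin> E" using down_closedD[OF Suc.prems(3), of i j i' j'] le eq u by auto
      then have "i + j \<le> s" using mx[of "(i, j)"] ij by auto
      then have "i = i' \<and> j = j'" using le eq u by auto
      then show False using ij eq by auto
    qed
    then show "(i', j') \<in> D - {u}" using down_closedD[OF Suc.prems(2), of i j i' j'] le ij by auto
  qed
  have "(\<Sum>T\<in>capped E D d. \<Prod>v\<in>D. cap_wt d T v) =
      (\<Sum>T\<in>capped E (D - {u}) d. \<Prod>v\<in>D - {u}. cap_wt d T v)"
    using Suc.prems u dc by (intro sum_capped_remove) auto
  also have "\<dots> = ssyt_sum E d"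
  proof (rule Suc.hyps(1))
    have "D - {u} - E = (D - E) - {u}" by auto
    then show "n = card (D - {u} - E)" using Suc.hyps(2) u fin by (simp add: card_Diff_singleton)
  qed (use Suc.prems u dc in auto)
  finally show ?case .
qed

section \<open>The branching rule\<close>

text \<open>The factor of a row of length \<open>m\<close> whose entries after position \<open>n\<close> all equal the letter with
  variable \<open>y\<close>. The exponent of \<open>q\<close> is \<open>Suc i\<close> as rows are numbered from 0 here.\<close>
definition row_prod :: "'a \<Rightarrow> nat \<Rightarrow> nat \<Rightarrow> nat \<Rightarrow> 'a" where
  "row_prod y i n m = (\<Prod>j\<in>{n<..m}. 1 - y * q ^ Suc i * r ^ j)"

text \<open>The factor contributed by row \<open>i\<close> to the branching rule; \<open>m\<close> and \<open>b\<close> are the lengths of rows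
  \<open>i\<close> and \<open>i + 1\<close> of the outer partition and \<open>n\<close> is the length of row \<open>i\<close> of the inner one. It
  is the increment of \<open>row_prod\<close> at \<open>n\<close>, with all of \<open>row_prod\<close> collected at the first value \<open>b\<close>.\<close>
definition branch_wt :: "'a \<Rightarrow> nat \<Rightarrow> nat \<Rightarrow> nat \<Rightarrow> nat \<Rightarrow> 'a" where
  "branch_wt y i n m b = row_prod y i n m * (if b < n then y * q ^ Suc i * r ^ n else 1)"

lemma row_prod_Suc_left: "n < m \<Longrightarrow> row_prod y i n m = (1 - y * q ^ Suc i * r ^ Suc n) * row_prod y i (Suc n) m"
proof -
  assume "n < m"
  then have "{n<..m} = insert (Suc n) {Suc n<..m}" by auto
  then show ?thesis by (simp add: row_prod_def)
qed

lemma row_prod_Suc_right: "n \<le> m \<Longrightarrow> row_prod y i n (Suc m) = row_prod y i n m * (1 - y * q ^ Suc i * r ^ Suc m)"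
proof -
  assume "n \<le> m"
  then have "{n<..Suc m} = insert (Suc m) {n<..m}" by auto
  then show ?thesis by (simp add: row_prod_def)
qed

lemma row_prod_empty: "m \<le> n \<Longrightarrow> row_prod y i n m = 1"
  by (simp add: row_prod_def)

lemma sum_branch_wt:
  assumes "b \<le> m"
  shows "(\<Sum>n\<in>{b..min m k}. branch_wt y i n m b) = (if b \<le> k then row_prod y i k m else 0)"
proof -
  have le: "(\<Sum>n\<in>{b..k}. branch_wt y i n m b) = row_prod y i k m" if "b \<le> k" "k \<le> m" for k
    using that
  proof (induction k rule: dec_induct)
    case base
    then show ?case by (simp add: branch_wt_def)
  next
    case (step k)
    then have "(\<Sum>n\<in>{b..Suc k}. branch_wt y i n m b) = row_prod y i k m + branch_wt y i (Suc k) m b" by simp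
    also have "\<dots> = row_prod y i (Suc k) m"
      using step by (simp add: row_prod_Suc_left[of k m] branch_wt_def algebra_simps)
    finally show ?case .
  qed
  show ?thesis
  proof (cases "k \<le> m")
    case True
    then show ?thesis using le[of k] by (auto simp: min_def)
  next
    case False
    then show ?thesis using le[of m] assms by (simp add: row_prod_empty)
  qed
qed

lemma capped_row_le:
  assumes T: "T \<in> capped E D d" and D: "down_closed D" and "1 \<le> j'" "j' \<le> j" "(i, j) \<in> D" "T (i, j) \<le> d"
  shows "T (i, j') \<le> d"
  using assms(4-6)
proof (induction j rule: dec_induct)
  case (step j)
  have "1 \<le> i" using down_closed_pos[OF D step.prems(1)] by simp
  then have "(i, j) \<in> D" using step assms(3) by (intro down_closedD[OF D step.prems(1)]) auto
  moreover have "T (i, j) \<le> low T (i, Suc j)" using step assms(3) by (auto simp: low_def)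
  moreover have "min (Suc d) (low T (i, Suc j)) \<le> T (i, Suc j)"
    using T step.prems(1) by (simp add: capped_def)
  then have "low T (i, Suc j) \<le> d" using step.prems(2) by simp
  ultimately show ?case using step.IH by linarith
qed

definition finite_count :: "nat \<Rightarrow> (nat \<Rightarrow> nat) \<Rightarrow> (cell \<Rightarrow> nat) \<Rightarrow> nat \<Rightarrow> nat" where
  "finite_count d f T i = card {j \<in> {1..f i}. T (Suc i, j) \<le> d}"

lemma finite_count_iff:
  assumes "T \<in> capped E (young f) d" "antimono f" "1 \<le> j" "j \<le> f i"
  shows "T (Suc i, j) \<le> d \<longleftrightarrow> j \<le> finite_count d f T i"
proof -
  let ?A = "{j \<in> {1..f i}. T (Suc i, j) \<le> d}"
  have "?A = {1..card ?A}"
  proof (rule initial_segment)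
    fix j j' assume "j \<in> ?A" "1 \<le> j'" "j' \<le> j"
    then show "j' \<in> ?A"
      using capped_row_le[OF assms(1) down_closed_young[OF assms(2)], of j' j "Suc i"] by auto
  qed auto
  then have "j \<in> ?A \<longleftrightarrow> j \<in> {1..card ?A}" by (rule arg_cong)
  then show ?thesis using assms(3,4) by (simp add: finite_count_def)
qed

text \<open>The tableaux with letters up to \<open>d + 1\<close> are the fillings in which infinity, read as the letter
  \<open>d + 1\<close>, occurs at most once in each column. Row \<open>i\<close> then has at least as many finite
  entries as row \<open>i + 1\<close> has cells, and its infinite cells contribute one more factor each.\<close>
lemma ssyt_sum_Suc_capped:
  assumes f: "antimono f" "\<forall>i\<ge>R. f i = 0"
  shows "ssyt_sum (young f) (Suc d) = (\<Sum>T\<in>capped {} (young f) d. (\<Prod>u\<in>young f. cap_wt d T u) *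
    (\<Prod>i<R. if f (Suc i) \<le> finite_count d f T i then row_prod (x (Suc d)) i (finite_count d f T i) (f i) else 0))"
  unfolding ssyt_sum_def
proof (rule sum.mono_neutral_cong_left)
  let ?D = "young f"
  show "finite (capped {} ?D d)" by (intro finite_capped finite_young[OF f(2)])
  show "tableaux ?D (Suc d) \<subseteq> capped {} ?D d" by (auto simp: tableaux_def capped_def)
  show "\<forall>T\<in>capped {} ?D d - tableaux ?D (Suc d). (\<Prod>u\<in>?D. cap_wt d T u) *
    (\<Prod>i<R. if f (Suc i) \<le> finite_count d f T i then row_prod (x (Suc d)) i (finite_count d f T i) (f i) else 0) = 0"
  proof
    fix T assume T: "T \<in> capped {} ?D d - tableaux ?D (Suc d)"
    have bd: "min (Suc d) (low T u) \<le> T u" "T u \<le> Suc d" if "u \<in> ?D" for u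
      using T that by (simp_all add: capped_def)
    \<comment> \<open>The filling is not a tableau only if some entry \<open>d + 1\<close> has another one directly above it.\<close>
    have "\<exists>u\<in>?D. \<not> low T u \<le> T u"
    proof (rule ccontr)
      assume "\<not> ?thesis"
      then have "T \<in> tableaux ?D (Suc d)" using T bd by (auto simp: capped_def tableaux_def)
      then show False using T by simp
    qed
    then obtain k j where u: "(k, j) \<in> ?D" "T (k, j) < low T (k, j)" by (metis not_le surj_pair)
    then have eq: "T (k, j) = Suc d" "Suc d < low T (k, j)" using bd[OF u(1)] by auto
    have kj: "1 \<le> k" "1 \<le> j" "j \<le> f (k - 1)" using u by (auto simp: young_def)
    have "T (k, j - 1) \<le> Suc d" if "1 < j"
      using kj that by (intro bd(2)) (auto simp: young_def)
    then have k1: "1 < k" "Suc d \<le> T (k - 1, j)"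
      using eq(2) by (auto simp: low_def max_def split: if_splits)
    define i where "i = k - 2"
    have k: "k = Suc (Suc i)" using k1(1) by (simp add: i_def)
    have "j \<le> f i" using kj k antimonoD[OF f(1), of i "Suc i"] by simp
    then have "finite_count d f T i < j"
      using finite_count_iff[of T "{}" f d j i] T f kj k k1 by auto
    then have "\<not> f (Suc i) \<le> finite_count d f T i" using kj k by simp
    moreover have "i < R"
    proof (rule ccontr)
      assume "\<not> i < R"
      then have "f (Suc i) = 0" using f(2) by simp
      then show False using kj k by simp
    qed
    ultimately have "(\<Prod>i<R. if f (Suc i) \<le> finite_count d f T i then row_prod (x (Suc d)) i (finite_count d f T i) (f i) else 0) = 0"
      by (intro prod_zero) auto
    then show "(\<Prod>u\<in>?D. cap_wt d T u) *
      (\<Prod>i<R. if f (Suc i) \<le> finite_count d f T i then row_prod (x (Suc d)) i (finite_count d f T i) (f i) else 0) = 0"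
      by simp
  qed
next
  let ?D = "young f"
  fix T assume T: "T \<in> tableaux ?D (Suc d)"
  then have cap: "T \<in> capped {} ?D d" by (auto simp: tableaux_def capped_def)
  have strict: "f (Suc i) \<le> finite_count d f T i" for i
  proof (rule ccontr)
    assume "\<not> ?thesis"
    then have j: "Suc (finite_count d f T i) \<le> f (Suc i)" by simp
    also have "f (Suc i) \<le> f i" by (intro antimonoD[OF f(1)]) simp
    finally have "\<not> T (Suc i, Suc (finite_count d f T i)) \<le> d"
      using finite_count_iff[OF cap f(1), of "Suc (finite_count d f T i)" i] by simp
    then have "Suc (Suc d) \<le> low T (Suc (Suc i), Suc (finite_count d f T i))"
      by (simp add: low_def)
    moreover have "low T u \<le> Suc d" if "u \<in> ?D" for u
      using T that by (auto simp: tableaux_def intro: order_trans)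
    moreover have "(Suc (Suc i), Suc (finite_count d f T i)) \<in> ?D" using j by simp
    ultimately show False by fastforce
  qed
  have "(\<Prod>u\<in>?D. (\<Prod>k\<in>{low T u..<T u}. letter_wt u k) * (1 - letter_wt u (T u))) =
      (\<Prod>u\<in>?D. cap_wt d T u * (if T u \<le> d then 1 else 1 - letter_wt u (Suc d)))"
  proof (rule prod.cong[OF refl])
    fix u assume "u \<in> ?D"
    then have "T u = Suc d" if "\<not> T u \<le> d" using T that by (simp add: tableaux_def le_antisym)
    then show "(\<Prod>k\<in>{low T u..<T u}. letter_wt u k) * (1 - letter_wt u (T u)) =
        cap_wt d T u * (if T u \<le> d then 1 else 1 - letter_wt u (Suc d))"
      by (simp add: cap_wt_def)
  qed
  also have "\<dots> = (\<Prod>u\<in>?D. cap_wt d T u) * (\<Prod>u\<in>?D. if T u \<le> d then 1 else 1 - letter_wt u (Suc d))"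
    by (rule prod.distrib)
  also have "(\<Prod>u\<in>?D. if T u \<le> d then 1 else 1 - letter_wt u (Suc d)) =
      (\<Prod>i<R. row_prod (x (Suc d)) i (finite_count d f T i) (f i))"
    unfolding prod_young[OF f(2)]
  proof (rule prod.cong[OF refl])
    fix i
    show "(\<Prod>j\<in>{1..f i}. if T (Suc i, j) \<le> d then 1 else 1 - letter_wt (Suc i, j) (Suc d)) =
        row_prod (x (Suc d)) i (finite_count d f T i) (f i)"
      unfolding row_prod_def
      by (rule prod.mono_neutral_cong_right)
        (auto simp: letter_wt_def finite_count_iff[OF cap f(1)] ac_simps)
  qed
  also have "\<dots> = (\<Prod>i<R. if f (Suc i) \<le> finite_count d f T i
      then row_prod (x (Suc d)) i (finite_count d f T i) (f i) else 0)"
    using strict by simp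
  finally show "(\<Prod>u\<in>?D. (\<Prod>k\<in>{low T u..<T u}. letter_wt u k) * (1 - letter_wt u (T u))) =
    (\<Prod>u\<in>?D. cap_wt d T u) * (\<Prod>i<R. if f (Suc i) \<le> finite_count d f T i
      then row_prod (x (Suc d)) i (finite_count d f T i) (f i) else 0)" .
qed

definition interlacing :: "nat \<Rightarrow> (nat \<Rightarrow> nat) \<Rightarrow> (nat \<Rightarrow> nat) set" where
  "interlacing R f = rows R (\<lambda>i. {f (Suc i)..f i})"

lemma interlacingD:
  assumes "g \<in> interlacing R f" "\<forall>i\<ge>R. f i = 0"
  shows "f (Suc i) \<le> g i" "g i \<le> f i" "i \<ge> R \<Longrightarrow> g i = 0" "antimono g"
proof -
  have *: "f (Suc i) \<le> g i \<and> g i \<le> f i" for i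
    using assms by (cases "i < R") (auto simp: interlacing_def rows_def)
  then show "f (Suc i) \<le> g i" "g i \<le> f i" by auto
  show "i \<ge> R \<Longrightarrow> g i = 0" using assms by (auto simp: interlacing_def rows_def)
  show "antimono g" unfolding antimono_iff_le_Suc using * order_trans by blast
qed

lemma finite_interlacing: "finite (interlacing R f)"
  unfolding interlacing_def by (rule finite_rows) simp

lemma sum_interlacing_below:
  assumes "antimono f"
  shows "(\<Sum>g\<in>{g. g \<in> interlacing R f \<and> (\<forall>i<R. g i \<le> k i)}. \<Prod>i<R. branch_wt y i (g i) (f i) (f (Suc i))) =
    (\<Prod>i<R. if f (Suc i) \<le> k i then row_prod y i (k i) (f i) else 0)"
proof -
  have "{g. g \<in> interlacing R f \<and> (\<forall>i<R. g i \<le> k i)} = rows R (\<lambda>i. {f (Suc i)..min (f i) (k i)})"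
    by (auto simp: interlacing_def rows_def)
  then have "(\<Sum>g\<in>{g. g \<in> interlacing R f \<and> (\<forall>i<R. g i \<le> k i)}. \<Prod>i<R. branch_wt y i (g i) (f i) (f (Suc i))) =
    (\<Prod>i<R. \<Sum>n\<in>{f (Suc i)..min (f i) (k i)}. branch_wt y i n (f i) (f (Suc i)))"
    using sum_prod_rows[of R "\<lambda>i. {f (Suc i)..min (f i) (k i)}" "\<lambda>i n. branch_wt y i n (f i) (f (Suc i))"]
    by simp
  also have "\<dots> = (\<Prod>i<R. if f (Suc i) \<le> k i then row_prod y i (k i) (f i) else 0)"
    by (intro prod.cong refl sum_branch_wt antimonoD[OF assms]) simp
  finally show ?thesis .
qed

text \<open>By \<open>ssyt_sum_Suc_capped\<close> the left-hand side is a sum over fillings of a product over rows that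
  depends on the number of finite entries in each row. These products are cumulative sums of
  \<open>branch_wt\<close>. Exchanging the summations leaves, for each interlacing \<open>g\<close>, the total weight
  of the fillings that are finite on \<open>g\<close>.\<close>
lemma branching:
  assumes f: "antimono f" "\<forall>i\<ge>R. f i = 0"
  shows "ssyt_sum (young f) (Suc d) =
    (\<Sum>g\<in>interlacing R f. (\<Prod>i<R. branch_wt (x (Suc d)) i (g i) (f i) (f (Suc i))) * ssyt_sum (young g) d)"
proof -
  let ?D = "young f" and ?Phi = "\<lambda>g. \<Prod>i<R. branch_wt (x (Suc d)) i (g i) (f i) (f (Suc i))"
  let ?W = "\<lambda>T. \<Prod>u\<in>?D. cap_wt d T u" and ?k = "finite_count d f"
  have fin: "finite ?D" by (rule finite_young[OF f(2)])
  have "ssyt_sum ?D (Suc d) = (\<Sum>T\<in>capped {} ?D d. \<Sum>g\<in>{g. g \<in> interlacing R f \<and> (\<forall>i<R. g i \<le> ?k T i)}. ?W T * ?Phi g)"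
    unfolding ssyt_sum_Suc_capped[OF f] sum_distrib_left[symmetric] sum_interlacing_below[OF f(1)] by (rule refl)
  also have "\<dots> = (\<Sum>g\<in>interlacing R f. \<Sum>T\<in>{T. T \<in> capped {} ?D d \<and> (\<forall>i<R. g i \<le> ?k T i)}. ?W T * ?Phi g)"
    by (rule sum.swap_restrict[OF finite_capped[OF fin] finite_interlacing])
  also have "\<dots> = (\<Sum>g\<in>interlacing R f. ?Phi g * ssyt_sum (young g) d)"
  proof (rule sum.cong[OF refl])
    fix g assume "g \<in> interlacing R f"
    note g = interlacingD[OF this f(2)]
    have sub: "young g \<subseteq> ?D" unfolding young_mono_iff le_fun_def using g(2) by blast
    have "{T. T \<in> capped {} ?D d \<and> (\<forall>i<R. g i \<le> ?k T i)} = capped (young g) ?D d"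
    proof (intro equalityI subsetI)
      fix T assume T: "T \<in> {T. T \<in> capped {} ?D d \<and> (\<forall>i<R. g i \<le> ?k T i)}"
      have "T u \<le> d" if "u \<in> young g" for u
      proof -
        obtain k j where u: "u = (k, j)" by (cases u)
        define i where "i = k - 1"
        have k: "k = Suc i" using that u by (simp add: young_def i_def)
        have j: "1 \<le> j" "j \<le> g i" using that u k by auto
        then have "i < R" using g(3)[of i] by (cases "i < R") auto
        then show ?thesis using finite_count_iff[of T "{}" f d j i] T f(1) j g(2)[of i] u k by auto
      qed
      then show "T \<in> capped (young g) ?D d" using T by (simp add: capped_def)
    next
      fix T assume T: "T \<in> capped (young g) ?D d"
      have "g i \<le> ?k T i" for i
      proof (cases "g i = 0")
        case False
        then have "(Suc i, g i) \<in> young g" by simp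
        then have "T (Suc i, g i) \<le> d" using T sub unfolding capped_def by blast
        then show ?thesis using finite_count_iff[OF T f(1), of "g i" i] g(2)[of i] False by simp
      qed simp
      then show "T \<in> {T. T \<in> capped {} ?D d \<and> (\<forall>i<R. g i \<le> ?k T i)}"
        using T by (simp add: capped_def)
    qed
    then show "(\<Sum>T\<in>{T. T \<in> capped {} ?D d \<and> (\<forall>i<R. g i \<le> ?k T i)}. ?W T * ?Phi g) = ?Phi g * ssyt_sum (young g) d"
      using sum_capped_eq_ssyt_sum[OF fin down_closed_young[OF f(1)] down_closed_young[OF g(4)] sub, of d]
      by (simp add: sum_distrib_right[symmetric] mult.commute)
  qed
  finally show ?thesis .
qed

section \<open>Specialised letters: vanishing and inversion\<close>

lemma ssyt_sum_zero_letters: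
  assumes "antimono f"
  shows "ssyt_sum (young f) 0 = (if f = (\<lambda>_. 0) then 1 else 0)"
proof (cases "f = (\<lambda>_. 0)")
  case True
  then have "young f = {}" by (auto simp: young_def)
  then show ?thesis using True by (simp add: ssyt_sum_def tableaux_def)
next
  case False
  then obtain i where "1 \<le> f i" by (metis One_nat_def Suc_leI neq0_conv)
  then have "(Suc i, 1) \<in> young f" by simp
  moreover have "T u \<noteq> 0" if "low T u \<le> T u" for T u using low_pos[of T u] that by linarith
  ultimately have "tableaux (young f) 0 = {}" unfolding tableaux_def by blast
  then show ?thesis using False by (simp add: ssyt_sum_def)
qed

text \<open>Dropping the last letter corresponds to dropping the first row of \<open>L\<close>, since the letters
  are matched with the rows of \<open>L\<close> in reverse order.\<close>
lemma letters_shift: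
  assumes "\<forall>k. 1 \<le> k \<and> k \<le> Suc d \<longrightarrow> x k = q ^ L (Suc d - k)"
  shows "\<forall>k. 1 \<le> k \<and> k \<le> d \<longrightarrow> x k = q ^ (L \<circ> Suc) (d - k)"
  using assms by (auto simp: Suc_diff_le)

text \<open>If some row of \<open>f\<close> below the first is longer than the same row of \<open>L\<close>, then every \<open>g\<close> that
  interlaces with \<open>f\<close> sticks out of \<open>L\<close> without its first row, and induction applies. Otherwise
  the first row sticks out. When \<open>g\<close> stays inside, the cell \<open>(1, L 0 + 1)\<close> contains the
  last letter and its factor is \<open>1 - q^0\<close>.\<close>
lemma ssyt_sum_vanishes:
  assumes "antimono f" "\<forall>i\<ge>R. f i = 0" "antimono L"
    and "\<forall>k. 1 \<le> k \<and> k \<le> d \<longrightarrow> x k = q ^ L (d - k)"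
    and "\<not> f \<le> L"
  shows "ssyt_sum (young f) d = 0"
  using assms
proof (induction d arbitrary: f L)
  case 0
  then have "f \<noteq> (\<lambda>_. 0)" by (auto simp: le_fun_def)
  then show ?case by (simp add: ssyt_sum_zero_letters 0)
next
  case (Suc d)
  have "(\<Prod>i<R. branch_wt (x (Suc d)) i (g i) (f i) (f (Suc i))) * ssyt_sum (young g) d = 0" if g: "g \<in> interlacing R f" for g
  proof (cases "g \<le> L \<circ> Suc")
    case False
    note gD = interlacingD[OF g Suc.prems(2)]
    have "antimono (L \<circ> Suc)" using Suc.prems(3) by (simp add: antimono_iff_le_Suc)
    then have "ssyt_sum (young g) d = 0"
      using gD(3,4) False by (intro Suc.IH[OF _ _ _ letters_shift[OF Suc.prems(4)]]) blast+
    then show ?thesis by simp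
  next
    case True
    note gD = interlacingD[OF g Suc.prems(2)]
    have below: "f (Suc i) \<le> L (Suc i)" for i
      using gD(1)[of i] le_funD[OF True, of i] by simp
    obtain i where "L i < f i" using Suc.prems(5) by (auto simp: le_fun_def not_le)
    then have f0: "L 0 < f 0" using below[of "i - 1"] by (cases i) auto
    have "g 0 \<le> L 0" using le_funD[OF True, of 0] antimonoD[OF Suc.prems(3), of 0 1] by simp
    then have "Suc (L 0) \<in> {g 0<..f 0}" using f0 by simp
    moreover have "1 - x (Suc d) * q ^ Suc 0 * r ^ Suc (L 0) = 0"
    proof -
      have "x (Suc d) = q ^ L 0" using Suc.prems(4) by simp
      then have "x (Suc d) * q ^ Suc 0 * r ^ Suc (L 0) = (q * r) ^ Suc (L 0)"
        by (simp add: power_mult_distrib)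
      then show ?thesis by (simp add: qr)
    qed
    ultimately have "row_prod (x (Suc d)) 0 (g 0) (f 0) = 0"
      unfolding row_prod_def by (intro prod_zero[OF finite_greaterThanAtMost] bexI)
    then have "branch_wt (x (Suc d)) 0 (g 0) (f 0) (f (Suc 0)) = 0" by (simp add: branch_wt_def)
    moreover have "0 < R" using f0 Suc.prems(2) by (cases R) auto
    ultimately have "(\<Prod>i<R. branch_wt (x (Suc d)) i (g i) (f i) (f (Suc i))) = 0"
      by (intro prod_zero) auto
    then show ?thesis by simp
  qed
  then show ?case unfolding branching[OF Suc.prems(1,2)] by (intro sum.neutral) blast
qed

text \<open>The telescoping identity behind the tableau side: downward induction on \<open>m\<close>, in which
  \<open>q r = 1\<close> makes the new summand cancel the last factor of the product.\<close>
lemma row_sum: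
  assumes "n \<le> m" "m \<le> c"
  shows "(\<Sum>k\<in>{m..c}. r ^ k * row_prod y i n k * (if k < c then y * q ^ i * r ^ c else 1)) = r ^ c * row_prod y i n m"
  using assms(2,1)
proof (induction m rule: inc_induct)
  case base
  then show ?case by simp
next
  case (step m)
  have "{m..c} = insert m {Suc m..c}" using step by auto
  then have "(\<Sum>k\<in>{m..c}. r ^ k * row_prod y i n k * (if k < c then y * q ^ i * r ^ c else 1)) =
      r ^ m * row_prod y i n m * (y * q ^ i * r ^ c) + r ^ c * row_prod y i n (Suc m)"
    using step by simp
  also have "\<dots> = r ^ c * row_prod y i n m + r ^ c * row_prod y i n m * y * q ^ i * r ^ m * (1 - q * r)"
    using step by (simp add: row_prod_Suc_right algebra_simps)
  finally show ?case by (simp add: qr)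
qed

lemma prod_shift:
  fixes g :: "nat \<Rightarrow> 'b::comm_monoid_mult"
  assumes "g R = 1"
  shows "(\<Prod>i<R. g i) = g 0 * (\<Prod>i<R. g (Suc i))"
  using prod.lessThan_Suc_shift[of g R] prod.lessThan_Suc[of g R] assms by simp

text \<open>The conditions on \<open>g\<close> say that row \<open>i\<close> of \<open>g\<close> lies between \<open>max (f i) (k i)\<close> and \<open>k (i - 1)\<close>, with
  \<open>L 0\<close> in the place of \<open>k (- 1)\<close>. In \<open>branch_wt\<close> the last factor of row \<open>i\<close> involves row \<open>i + 1\<close> of \<open>g\<close>;
  moving it to row \<open>i + 1\<close> makes the sum a product over rows, to which \<open>row_sum\<close> applies.\<close>
lemma inversion_coefficient:
  assumes L: "antimono L" "L R = 0" "y = q ^ L 0"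
    and f: "f \<le> L"
    and k: "antimono k" "k \<le> L \<circ> Suc"
  shows "(\<Sum>g\<in>{g. g \<in> between f L \<and> k \<in> interlacing R g}. r ^ (\<Sum>i<R. g i) * (\<Prod>i<R. branch_wt y i (k i) (g i) (g (Suc i)))) =
    r ^ L 0 * r ^ (\<Sum>i<R. k i) * (\<Prod>i<R. if f (Suc i) \<le> k i then row_prod y i (k i) (f i) else 0)"
proof -
  define up where "up = (\<lambda>i. case i of 0 \<Rightarrow> L 0 | Suc j \<Rightarrow> k j)"
  have up0: "up 0 = L 0" and upS: "up (Suc i) = k i" for i by (simp_all add: up_def)
  have LR: "L i = 0" if "R \<le> i" for i using antimonoD[OF L(1) that] L(2) by simp
  have kL: "k i \<le> L (Suc i)" for i using le_funD[OF k(2), of i] by simp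
  have fL: "f i \<le> L i" for i using le_funD[OF f] .
  have kR: "k i = 0" if "R \<le> Suc i" for i using kL[of i] LR[OF that] by simp
  have up_le: "up i \<le> L i" for i using kL by (cases i) (simp_all add: up0 upS)
  have upR: "up R = 0" using up_le[of R] L(2) by simp
  have fR: "f i = 0" if "R \<le> i" for i using fL[of i] LR[OF that] by simp
  have k_up: "k i \<le> up i" for i
  proof (cases i)
    case 0
    then show ?thesis using kL[of 0] antimonoD[OF L(1), of 0 1] by (simp add: up0)
  next
    case (Suc j)
    then show ?thesis using antimonoD[OF k(1), of j i] by (simp add: upS)
  qed
  \<comment> \<open>The factor that row 0 would receive from a row above it is 1: this is where \<open>y\<close> has to be the
     variable belonging to the first row of \<open>L\<close>.\<close>
  have yq: "y * q ^ 0 * r ^ up 0 = 1"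
    using qr by (simp add: L(3) up0 power_mult_distrib[symmetric])
  have set_eq: "{g. g \<in> between f L \<and> k \<in> interlacing R g} = rows R (\<lambda>i. {max (f i) (k i)..up i})"
  proof (intro equalityI subsetI)
    fix g assume g: "g \<in> {g. g \<in> between f L \<and> k \<in> interlacing R g}"
    then have gL: "g i \<le> L i" and fg: "f i \<le> g i" for i by (auto simp: between_def le_fun_def)
    have gR: "\<forall>i\<ge>R. g i = 0" using gL LR by (metis le_zero_eq)
    have "k \<in> interlacing R g" using g by simp
    note kD = interlacingD[OF this gR]
    have "g i \<le> up i" for i using kD(1) gL by (cases i) (simp_all add: up0 upS)
    then show "g \<in> rows R (\<lambda>i. {max (f i) (k i)..up i})"
      using kD(2) fg gR by (simp add: rows_def)
  next
    fix g assume g: "g \<in> rows R (\<lambda>i. {max (f i) (k i)..up i})"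
    have gR: "g i = 0" if "R \<le> i" for i using g that by (simp add: rows_def)
    have g_up: "g i \<le> up i" and fg: "f i \<le> g i" and kg: "k i \<le> g i" for i
      using g fR[of i] kR[of i] gR[of i] by (cases "i < R"; simp add: rows_def)+
    have gk: "g (Suc i) \<le> k i" for i using g_up[of "Suc i"] by (simp add: upS)
    have "antimono g" unfolding antimono_iff_le_Suc using gk kg order_trans by blast
    moreover have "f \<le> g" "g \<le> L" using fg g_up up_le unfolding le_fun_def by (blast intro: order_trans)+
    ultimately show "g \<in> {g. g \<in> between f L \<and> k \<in> interlacing R g}"
      using gk kg kR by (simp add: between_def interlacing_def rows_def)
  qed
  let ?s = "\<lambda>i n. if n < up i then y * q ^ i * r ^ up i else 1"
  let ?m = "\<lambda>i. max (f i) (k i)"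
  have "(\<Sum>g\<in>rows R (\<lambda>i. {?m i..up i}). r ^ (\<Sum>i<R. g i) * (\<Prod>i<R. branch_wt y i (k i) (g i) (g (Suc i)))) =
     (\<Sum>g\<in>rows R (\<lambda>i. {?m i..up i}). \<Prod>i<R. r ^ g i * row_prod y i (k i) (g i) * ?s i (g i))"
  proof (rule sum.cong[OF refl])
    fix g assume "g \<in> rows R (\<lambda>i. {?m i..up i})"
    then have gR: "g R = 0" by (simp add: rows_def)
    have shift: "(\<Prod>i<R. ?s i (g i)) = (\<Prod>i<R. ?s (Suc i) (g (Suc i)))"
      by (subst prod_shift) (use yq upR gR in auto)
    have "(\<Prod>i<R. branch_wt y i (k i) (g i) (g (Suc i))) = (\<Prod>i<R. row_prod y i (k i) (g i) * ?s (Suc i) (g (Suc i)))"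
      unfolding branch_wt_def upS ..
    also have "\<dots> = (\<Prod>i<R. row_prod y i (k i) (g i)) * (\<Prod>i<R. ?s i (g i))"
      unfolding prod.distrib shift ..
    finally show "r ^ (\<Sum>i<R. g i) * (\<Prod>i<R. branch_wt y i (k i) (g i) (g (Suc i))) =
        (\<Prod>i<R. r ^ g i * row_prod y i (k i) (g i) * ?s i (g i))"
      unfolding prod.distrib power_sum by (simp add: mult.assoc)
  qed
  also have "\<dots> = (\<Prod>i<R. \<Sum>n\<in>{?m i..up i}. r ^ n * row_prod y i (k i) n * ?s i n)"
    by (rule sum_prod_rows) simp
  also have "\<dots> = (\<Prod>i<R. (if f i \<le> up i then r ^ up i else 0) * row_prod y i (k i) (f i))"
  proof (rule prod.cong[OF refl])
    fix i
    have max_irrelevant: "row_prod y i (k i) (?m i) = row_prod y i (k i) (f i)" by (simp add: max_def row_prod_empty)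
    show "(\<Sum>n\<in>{?m i..up i}. r ^ n * row_prod y i (k i) n * ?s i n) = (if f i \<le> up i then r ^ up i else 0) * row_prod y i (k i) (f i)"
    proof (cases "f i \<le> up i")
      case True
      then show ?thesis using row_sum[of "k i" "?m i" "up i" y i] k_up[of i] max_irrelevant by simp
    qed simp
  qed
  also have "\<dots> = (\<Prod>i<R. if f i \<le> up i then r ^ up i else 0) * (\<Prod>i<R. row_prod y i (k i) (f i))"
    by (rule prod.distrib)
  also have "(\<Prod>i<R. if f i \<le> up i then r ^ up i else 0) = r ^ L 0 * (\<Prod>i<R. if f (Suc i) \<le> k i then r ^ k i else 0)"
    using prod_shift[of "\<lambda>i. if f i \<le> up i then r ^ up i else 0" R] upR fR[of R] fL[of 0]
    unfolding up0 upS by simp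
  also have "r ^ L 0 * (\<Prod>i<R. if f (Suc i) \<le> k i then r ^ k i else 0) * (\<Prod>i<R. row_prod y i (k i) (f i)) =
      r ^ L 0 * (\<Prod>i<R. r ^ k i * (if f (Suc i) \<le> k i then row_prod y i (k i) (f i) else 0))"
    unfolding mult.assoc prod.distrib[symmetric]
    by (intro arg_cong[where f = "(*) (r ^ L 0)"] prod.cong refl) simp
  also have "\<dots> = r ^ L 0 * r ^ (\<Sum>i<R. k i) * (\<Prod>i<R. if f (Suc i) \<le> k i then row_prod y i (k i) (f i) else 0)"
    unfolding prod.distrib power_sum by (simp add: mult.assoc)
  finally show ?thesis unfolding set_eq .
qed

text \<open>The induction step expands \<open>f\<close> by the branching rule and each term by the induction
  hypothesis. The right-hand side is expanded by the branching rule as well, and the coefficients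
  of \<open>ssyt_sum (young k) d\<close> agree by \<open>inversion_coefficient\<close>.\<close>
lemma inversion:
  assumes "d \<le> R" "antimono L" "\<forall>i\<ge>d. L i = 0"
    and "\<forall>k. 1 \<le> k \<and> k \<le> d \<longrightarrow> x k = q ^ L (d - k)"
    and "antimono f" "\<forall>i\<ge>R. f i = 0"
  shows "r ^ (\<Sum>i<R. L i) * ssyt_sum (young f) d = (\<Sum>g\<in>between f L. r ^ (\<Sum>i<R. g i) * ssyt_sum (young g) d)"
  using assms
proof (induction d arbitrary: f L)
  case 0
  have L0: "L = (\<lambda>_. 0)" using 0 by auto
  show ?case
  proof (cases "f = (\<lambda>_. 0)")
    case True
    then have "between f L = {f}" using L0 by (auto simp: between_def antimono_def intro: order_antisym)
    then show ?thesis using True L0 by simp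
  next
    case False
    then have "between f L = {}" using L0 by (auto simp: between_def le_fun_def fun_eq_iff)
    then show ?thesis using False by (simp only: ssyt_sum_zero_letters[OF 0(5)]) simp
  qed
next
  case (Suc d)
  let ?L = "L \<circ> Suc"
  have L': "antimono ?L" "\<forall>i\<ge>d. ?L i = 0" using Suc.prems(2,3) by (simp_all add: antimono_iff_le_Suc)
  have x': "\<forall>k. 1 \<le> k \<and> k \<le> d \<longrightarrow> x k = q ^ ?L (d - k)" by (rule letters_shift[OF Suc.prems(4)])
  have y: "x (Suc d) = q ^ L 0" using Suc.prems(4) by simp
  have LR: "\<forall>i\<ge>R. L i = 0" and L'R: "\<forall>i\<ge>R. ?L i = 0" using Suc.prems(1,3) by simp_all
  show ?case
  proof (cases "f \<le> L")
    case False
    then have "between f L = {}" by (auto simp: between_def intro: order_trans)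
    then show ?thesis using ssyt_sum_vanishes[OF Suc.prems(5,6,2,4) False] by simp
  next
    case True
    let ?Phi = "\<lambda>f g. \<Prod>i<R. branch_wt (x (Suc d)) i (g i) (f i) (f (Suc i))"
    let ?P = "between (\<lambda>_. 0) ?L"
    let ?c = "\<lambda>k. r ^ L 0 * r ^ (\<Sum>i<R. k i) * (\<Prod>i<R. if f (Suc i) \<le> k i then row_prod (x (Suc d)) i (k i) (f i) else 0) * ssyt_sum (young k) d"
    have finP: "finite ?P" by (rule finite_between[OF L'R])
    have kR: "\<forall>i\<ge>R. k i = 0" if "k \<in> ?P" for k
      using that L'R unfolding between_def le_fun_def by (metis (mono_tags, lifting) le_zero_eq mem_Collect_eq)
    have "r ^ (\<Sum>i<R. L i) * ssyt_sum (young f) (Suc d) = r ^ L 0 * (\<Sum>g\<in>interlacing R f. ?Phi f g * (r ^ (\<Sum>i<R. ?L i) * ssyt_sum (young g) d))"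
    proof -
      have "(\<Sum>i<R. L i) = L 0 + (\<Sum>i<R. ?L i)"
        using sum.lessThan_Suc_shift[of L R] sum.lessThan_Suc[of L R] LR by simp
      then show ?thesis
        unfolding branching[OF Suc.prems(5,6)] by (simp add: sum_distrib_left power_add ac_simps)
    qed
    also have "\<dots> = r ^ L 0 * (\<Sum>g\<in>interlacing R f. \<Sum>k\<in>{k. k \<in> ?P \<and> (\<forall>i<R. g i \<le> k i)}. ?Phi f g * (r ^ (\<Sum>i<R. k i) * ssyt_sum (young k) d))"
    proof (intro arg_cong2[of _ _ _ _ "(*)"] refl sum.cong)
      fix g assume g: "g \<in> interlacing R f"
      note gD = interlacingD[OF g Suc.prems(6)]
      have "between g ?L = {k. k \<in> ?P \<and> (\<forall>i<R. g i \<le> k i)}"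
      proof (intro equalityI subsetI)
        fix k assume k: "k \<in> {k. k \<in> ?P \<and> (\<forall>i<R. g i \<le> k i)}"
        then have "g i \<le> k i" for i using gD(3)[of i] by (cases "i < R") auto
        then show "k \<in> between g ?L" using k by (simp add: between_def le_fun_def)
      qed (auto simp: between_def le_fun_def)
      moreover have "r ^ (\<Sum>i<R. ?L i) * ssyt_sum (young g) d = (\<Sum>k\<in>between g ?L. r ^ (\<Sum>i<R. k i) * ssyt_sum (young k) d)"
        using Suc.prems(1) gD(3,4) by (intro Suc.IH[OF _ L' x']) auto
      ultimately show "?Phi f g * (r ^ (\<Sum>i<R. ?L i) * ssyt_sum (young g) d) =
          (\<Sum>k\<in>{k. k \<in> ?P \<and> (\<forall>i<R. g i \<le> k i)}. ?Phi f g * (r ^ (\<Sum>i<R. k i) * ssyt_sum (young k) d))"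
        by (simp add: sum_distrib_left)
    qed
    also have "\<dots> = r ^ L 0 * (\<Sum>k\<in>?P. \<Sum>g\<in>{g. g \<in> interlacing R f \<and> (\<forall>i<R. g i \<le> k i)}. ?Phi f g * (r ^ (\<Sum>i<R. k i) * ssyt_sum (young k) d))"
      unfolding sum.swap_restrict[OF finite_interlacing finP] ..
    also have "\<dots> = (\<Sum>k\<in>?P. ?c k)"
      unfolding sum_distrib_right[symmetric] sum_interlacing_below[OF Suc.prems(5)]
      by (simp add: sum_distrib_left ac_simps)
    also have "\<dots> = (\<Sum>k\<in>?P. \<Sum>g\<in>{g. g \<in> between f L \<and> k \<in> interlacing R g}. r ^ (\<Sum>i<R. g i) * ?Phi g k * ssyt_sum (young k) d)"
    proof (rule sum.cong[OF refl])
      fix k assume "k \<in> ?P"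
      then have k: "antimono k" "k \<le> ?L" by (simp_all add: between_def)
      show "?c k = (\<Sum>g\<in>{g. g \<in> between f L \<and> k \<in> interlacing R g}. r ^ (\<Sum>i<R. g i) * ?Phi g k * ssyt_sum (young k) d)"
        unfolding sum_distrib_right[symmetric]
        by (subst inversion_coefficient[OF Suc.prems(2) _ y True k]) (use LR in auto)
    qed
    also have "\<dots> = (\<Sum>g\<in>between f L. \<Sum>k\<in>{k. k \<in> ?P \<and> k \<in> interlacing R g}. r ^ (\<Sum>i<R. g i) * ?Phi g k * ssyt_sum (young k) d)"
      by (rule sum.swap_restrict[OF finP finite_between[OF LR]])
    also have "\<dots> = (\<Sum>g\<in>between f L. r ^ (\<Sum>i<R. g i) * ssyt_sum (young g) (Suc d))"
    proof (rule sum.cong[OF refl])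
      fix g assume g: "g \<in> between f L"
      have gR: "\<forall>i\<ge>R. g i = 0"
        using g LR unfolding between_def le_fun_def by (metis (mono_tags, lifting) le_zero_eq mem_Collect_eq)
      have g': "antimono g" using g by (simp add: between_def)
      have "(\<Sum>k\<in>{k. k \<in> ?P \<and> k \<in> interlacing R g}. r ^ (\<Sum>i<R. g i) * ?Phi g k * ssyt_sum (young k) d) =
        (\<Sum>k\<in>interlacing R g. r ^ (\<Sum>i<R. g i) * ?Phi g k * ssyt_sum (young k) d)"
      proof (rule sum.mono_neutral_left[OF finite_interlacing])
        \<comment> \<open>The partitions outside \<open>L\<close> without its first row contribute nothing.\<close>
        show "\<forall>k\<in>interlacing R g - {k. k \<in> ?P \<and> k \<in> interlacing R g}. r ^ (\<Sum>i<R. g i) * ?Phi g k * ssyt_sum (young k) d = 0"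
        proof
          fix k assume k: "k \<in> interlacing R g - {k. k \<in> ?P \<and> k \<in> interlacing R g}"
          then have "k \<in> interlacing R g" by simp
          note kD = interlacingD[OF this gR]
          have "\<not> k \<le> ?L" using k kD(4) by (auto simp: between_def le_fun_def)
          then have "ssyt_sum (young k) d = 0"
            using kD(3,4) by (intro ssyt_sum_vanishes[OF _ _ L'(1) x']) blast+
          then show "r ^ (\<Sum>i<R. g i) * ?Phi g k * ssyt_sum (young k) d = 0" by simp
        qed
      qed auto
      then show "(\<Sum>k\<in>{k. k \<in> ?P \<and> k \<in> interlacing R g}. r ^ (\<Sum>i<R. g i) * ?Phi g k * ssyt_sum (young k) d) =
          r ^ (\<Sum>i<R. g i) * ssyt_sum (young g) (Suc d)"
        unfolding branching[OF g' gR] by (simp add: sum_distrib_left mult.assoc)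
    qed
    finally show ?thesis .
  qed
qed

end

section \<open>Reverse plane partitions\<close>

definition rpp_with_support :: "cell set \<Rightarrow> cell set \<Rightarrow> (cell \<Rightarrow> nat) set" where
  "rpp_with_support A B = {T. is_rpp A T \<and> (\<forall>u\<in>A. T u \<noteq> 0 \<longleftrightarrow> u \<in> B)}"

text \<open>Subtracting 1 from all entries on an upper set \<open>B\<close> turns the reverse plane partitions that are
  nonzero exactly on \<open>B\<close> into all reverse plane partitions of \<open>B\<close>.\<close>
lemma card_rpp_shift:
  assumes fin: "finite A" and sub: "B \<subseteq> A"
    and upper: "\<And>i j j'. (i, j) \<in> B \<Longrightarrow> (i, j') \<in> A \<Longrightarrow> j < j' \<Longrightarrow> (i, j') \<in> B"
      "\<And>i i' j. (i, j) \<in> B \<Longrightarrow> (i', j) \<in> A \<Longrightarrow> i < i' \<Longrightarrow> (i', j) \<in> B"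
  shows "card {T. T \<in> rpp_with_support A B \<and> (\<Sum>u\<in>A. T u) = n} =
    (if card B \<le> n then card {T. is_rpp B T \<and> (\<Sum>u\<in>B. T u) = n - card B} else 0)"
proof -
  have finB: "finite B" using fin sub finite_subset by blast
  have sumB: "(\<Sum>u\<in>A. T u) = (\<Sum>u\<in>B. T u - 1) + card B" if "T \<in> rpp_with_support A B" for T
  proof -
    have "(\<Sum>u\<in>A. T u) = (\<Sum>u\<in>B. T u)"
      using that by (intro sum.mono_neutral_right fin sub) (auto simp: rpp_with_support_def)
    also have "\<dots> = (\<Sum>u\<in>B. (T u - 1) + 1)"
      using that sub by (intro sum.cong refl) (fastforce simp: rpp_with_support_def)
    finally show ?thesis unfolding sum.distrib by simp
  qed
  show ?thesis
  proof (cases "card B \<le> n")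
    case False
    then have "{T. T \<in> rpp_with_support A B \<and> (\<Sum>u\<in>A. T u) = n} = {}" using sumB by fastforce
    then show ?thesis using False by (simp only: card.empty if_False)
  next
    case True
    let ?down = "\<lambda>T. restrict (\<lambda>u. T u - 1) B"
    let ?up = "\<lambda>T. restrict (\<lambda>u. if u \<in> B then Suc (T u) else 0) A"
    have "bij_betw ?down {T. T \<in> rpp_with_support A B \<and> (\<Sum>u\<in>A. T u) = n} {T. is_rpp B T \<and> (\<Sum>u\<in>B. T u) = n - card B}"
    proof (rule bij_betw_byWitness[where f' = ?up])
      show "\<forall>T\<in>{T. T \<in> rpp_with_support A B \<and> (\<Sum>u\<in>A. T u) = n}. ?up (?down T) = T"
      proof (intro ballI ext)
        fix T u assume T: "T \<in> {T. T \<in> rpp_with_support A B \<and> (\<Sum>u\<in>A. T u) = n}"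
        then have ext: "T \<in> extensional A" and nz: "u \<in> A \<Longrightarrow> T u \<noteq> 0 \<longleftrightarrow> u \<in> B"
          by (auto simp: rpp_with_support_def is_rpp_def)
        show "?up (?down T) u = T u"
          using nz extensional_arb[OF ext, of u] by (cases "u \<in> A") auto
      qed
      show "\<forall>T\<in>{T. is_rpp B T \<and> (\<Sum>u\<in>B. T u) = n - card B}. ?down (?up T) = T"
      proof (intro ballI ext)
        fix T u assume T: "T \<in> {T. is_rpp B T \<and> (\<Sum>u\<in>B. T u) = n - card B}"
        then have ext: "T \<in> extensional B" by (simp add: is_rpp_def)
        show "?down (?up T) u = T u"
          using extensional_arb[OF ext, of u] sub by (cases "u \<in> B") auto
      qed
      show "?down ` {T. T \<in> rpp_with_support A B \<and> (\<Sum>u\<in>A. T u) = n} \<subseteq> {T. is_rpp B T \<and> (\<Sum>u\<in>B. T u) = n - card B}"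
      proof (rule image_subsetI)
        fix T assume T: "T \<in> {T. T \<in> rpp_with_support A B \<and> (\<Sum>u\<in>A. T u) = n}"
        then have "is_rpp A T" by (simp add: rpp_with_support_def)
        then have "is_rpp B (?down T)"
          using sub unfolding is_rpp_def by (simp add: subset_iff diff_le_mono)
        moreover have "(\<Sum>u\<in>B. ?down T u) = n - card B" using sumB[of T] T by simp
        ultimately show "?down T \<in> {T. is_rpp B T \<and> (\<Sum>u\<in>B. T u) = n - card B}" by simp
      qed
      show "?up ` {T. is_rpp B T \<and> (\<Sum>u\<in>B. T u) = n - card B} \<subseteq> {T. T \<in> rpp_with_support A B \<and> (\<Sum>u\<in>A. T u) = n}"
      proof (rule image_subsetI)
        fix T assume T: "T \<in> {T. is_rpp B T \<and> (\<Sum>u\<in>B. T u) = n - card B}"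
        then have rpp: "is_rpp B T" by simp
        have "is_rpp A (?up T)"
          unfolding is_rpp_def
        proof (intro conjI allI impI)
          show "?up T \<in> extensional A" by simp
          fix i j j' assume h: "(i, j) \<in> A" "(i, j') \<in> A" "j < j'"
          then show "?up T (i, j) \<le> ?up T (i, j')"
            using upper(1)[OF _ h(2,3)] rpp unfolding is_rpp_def by auto
        next
          fix i i' j assume h: "(i, j) \<in> A" "(i', j) \<in> A" "i < i'"
          then show "?up T (i, j) \<le> ?up T (i', j)"
            using upper(2)[OF _ h(2,3)] rpp unfolding is_rpp_def by auto
        qed
        then have up: "?up T \<in> rpp_with_support A B" by (simp add: rpp_with_support_def)
        have "(\<Sum>u\<in>B. ?up T u - 1) = (\<Sum>u\<in>B. T u)"
          using sub by (intro sum.cong refl) (simp add: subsetD)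
        then have "(\<Sum>u\<in>A. ?up T u) = n" using sumB[OF up] T True by simp
        then show "?up T \<in> {T. T \<in> rpp_with_support A B \<and> (\<Sum>u\<in>A. T u) = n}" using up by simp
      qed
    qed
    then show ?thesis using True by (simp add: bij_betw_same_card)
  qed
qed

text \<open>The zeros of a reverse plane partition form a lower set of the skew shape. For two cells of the
  skew shape this uses the corner cell in the row of the one and the column of the other, which
  belongs to the skew shape, too.\<close>
lemma zero_set_young:
  assumes L: "antimono L" "\<forall>i\<ge>R. L i = 0" and f: "antimono f" "f \<le> L"
    and T: "is_rpp (young L - young f) T"
  obtains g where "g \<in> between f L" "T \<in> rpp_with_support (young L - young f) (young L - young g)"
proof -
  let ?D = "young f \<union> {u \<in> young L - young f. T u = 0}"
  note dL = down_closed_young[OF L(1)] and df = down_closed_young[OF f(1)]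
  have sub: "young f \<subseteq> young L" using f(2) by (simp add: young_mono_iff)
  have "down_closed ?D"
    unfolding down_closed_def
  proof (intro allI impI conjI)
    fix i j assume ij: "(i, j) \<in> ?D"
    then have ijL: "(i, j) \<in> young L" using sub by auto
    show "1 \<le> i" "1 \<le> j" using down_closed_pos[OF dL ijL] by auto
    fix i' j' assume le: "1 \<le> i' \<and> i' \<le> i \<and> 1 \<le> j' \<and> j' \<le> j"
    show "(i', j') \<in> ?D"
    proof (cases "(i', j') \<in> young f")
      case False
      have L': "(i', j') \<in> young L" "(i', j) \<in> young L"
        using le by (auto intro!: down_closedD[OF dL ijL])
      have n1: "(i', j) \<notin> young f" using False le down_closedD[OF df, of i' j i' j'] by auto
      have n2: "(i, j) \<notin> young f" using False le down_closedD[OF df, of i j i' j'] by auto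
      have "T (i', j') \<le> T (i', j)"
        using T L' n1 False le unfolding is_rpp_def by (cases "j' = j") auto
      also have "\<dots> \<le> T (i, j)"
        using T L' ijL n1 n2 le unfolding is_rpp_def by (cases "i' = i") auto
      also have "\<dots> = 0" using ij n2 by auto
      finally show ?thesis using L' False by simp
    qed simp
  qed
  moreover have "finite ?D" using finite_young[OF L(2)] sub by (auto intro: finite_subset)
  ultimately obtain g where g: "antimono g" "?D = young g" by (rule down_closed_eq_young)
  have "young f \<subseteq> young g" "young g \<subseteq> young L" using g(2) sub by auto
  then have "g \<in> between f L" using g(1) by (simp add: between_def young_mono_iff)
  moreover have "T \<in> rpp_with_support (young L - young f) (young L - young g)"
    using T unfolding g(2)[symmetric] rpp_with_support_def by auto
  ultimately show thesis by (rule that)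
qed

lemma card_young_diff:
  assumes "\<forall>i\<ge>R. L i = 0" "g \<le> L"
  shows "card (young L - young g) + (\<Sum>i<R. g i) = (\<Sum>i<R. L i)"
proof -
  have gR: "\<forall>i\<ge>R. g i = 0" using assms unfolding le_fun_def by (metis le_zero_eq)
  have "young g \<subseteq> young L" using assms(2) by (simp add: young_mono_iff)
  then have "card (young L - young g) + card (young g) = card (young L)"
    using finite_young[OF assms(1)] finite_young[OF gR]
    by (metis card_Diff_subset card_mono le_add_diff_inverse2)
  then show ?thesis by (simp add: card_young[OF assms(1)] card_young[OF gR])
qed

lemma rpp_by_zero_set:
  assumes L: "antimono L" "\<forall>i\<ge>R. L i = 0" and f: "antimono f" "f \<le> L"
  shows "rpp (young L - young f) = (\<Sum>g\<in>between f L. fps_X ^ card (young L - young g) * rpp (young L - young g))"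
proof (rule fps_ext)
  fix n
  let ?A = "young L - young f" and ?B = "\<lambda>g. young L - young g"
  let ?S = "\<lambda>g. {T. T \<in> rpp_with_support ?A (?B g) \<and> (\<Sum>u\<in>?A. T u) = n}"
  have finA: "finite ?A" using finite_young[OF L(2)] by simp
  have "{T. is_rpp ?A T \<and> (\<Sum>u\<in>?A. T u) = n} = (\<Union>g\<in>between f L. ?S g)"
    by (auto simp: rpp_with_support_def elim!: zero_set_young[OF L f])
  moreover have "card (\<Union>g\<in>between f L. ?S g) = (\<Sum>g\<in>between f L. card (?S g))"
  proof (rule card_UN_disjoint[OF finite_between[OF L(2)]])
    show "\<forall>g\<in>between f L. finite (?S g)"
      using finite_rpp_of_size[OF finA, of n] by (auto intro: finite_subset[rotated] simp: rpp_with_support_def)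
    show "\<forall>g\<in>between f L. \<forall>h\<in>between f L. g \<noteq> h \<longrightarrow> ?S g \<inter> ?S h = {}"
    proof (intro ballI impI equals0I)
      fix g h T assume gh: "g \<in> between f L" "h \<in> between f L" "g \<noteq> h" and T: "T \<in> ?S g \<inter> ?S h"
      have "young f \<subseteq> young g" "young f \<subseteq> young h" "young g \<subseteq> young L" "young h \<subseteq> young L"
        using gh by (simp_all add: between_def young_mono_iff)
      moreover have "u \<in> ?B g \<longleftrightarrow> u \<in> ?B h" if "u \<in> ?A" for u
        using T that unfolding rpp_with_support_def by blast
      ultimately have "young g = young h" by blast
      then show False using gh(3) by (simp add: young_inject)
    qed
  qed
  moreover have "of_nat (card (?S g)) = (fps_X ^ card (?B g) * rpp (?B g)) $ n" if "g \<in> between f L" for g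
  proof -
    have g: "antimono g" "young f \<subseteq> young g" using that by (simp_all add: between_def young_mono_iff)
    note dg = down_closed_young[OF g(1)] and dL = down_closed_young[OF L(1)]
    have "card (?S g) = (if card (?B g) \<le> n then card {T. is_rpp (?B g) T \<and> (\<Sum>u\<in>?B g. T u) = n - card (?B g)} else 0)"
    proof (rule card_rpp_shift[OF finA])
      show "?B g \<subseteq> ?A" using g(2) by blast
    next
      fix i j j' assume "(i, j) \<in> ?B g" "(i, j') \<in> ?A" "j < j'"
      then show "(i, j') \<in> ?B g"
        using down_closedD[OF dg, of i j' i j] down_closed_pos[OF dL, of i j] by auto
    next
      fix i i' j assume "(i, j) \<in> ?B g" "(i', j) \<in> ?A" "i < i'"
      then show "(i', j) \<in> ?B g"
        using down_closedD[OF dg, of i' j i j] down_closed_pos[OF dL, of i j] by auto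
    qed
    then show ?thesis by (simp add: rpp_def fps_X_power_mult_nth)
  qed
  ultimately show "rpp ?A $ n = (\<Sum>g\<in>between f L. fps_X ^ card (?B g) * rpp (?B g)) $ n"
    by (simp add: rpp_def fps_sum_nth)
qed

text \<open>Downward induction on \<open>f\<close>: all terms except the one at \<open>f\<close> are covered by the induction
  hypothesis, and the coefficient \<open>r^|L| - r^|f|\<close> can be cancelled.\<close>
lemma inversion_unique:
  fixes F H :: "(nat \<Rightarrow> nat) \<Rightarrow> 'a::field" and r :: 'a
  assumes L: "\<forall>i\<ge>R. L i = 0" and r: "\<And>m n. r ^ m = r ^ n \<Longrightarrow> m = n"
    and F: "\<And>f. antimono f \<Longrightarrow> f \<le> L \<Longrightarrow> r ^ (\<Sum>i<R. L i) * F f = (\<Sum>g\<in>between f L. r ^ (\<Sum>i<R. g i) * F g)"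
    and H: "\<And>f. antimono f \<Longrightarrow> f \<le> L \<Longrightarrow> r ^ (\<Sum>i<R. L i) * H f = (\<Sum>g\<in>between f L. r ^ (\<Sum>i<R. g i) * H g)"
    and f: "antimono f" "f \<le> L"
  shows "F f * H L = H f * F L"
  using f
proof (induction "(\<Sum>i<R. L i) - (\<Sum>i<R. f i)" arbitrary: f rule: less_induct)
  case less
  let ?n = "\<lambda>f. \<Sum>i<R. f i"
  have size: "card (young L - young g) + ?n g = ?n L" if "g \<le> L" for g :: "nat \<Rightarrow> nat"
    by (rule card_young_diff[OF L that])
  show ?case
  proof (cases "f = L")
    case False
    have fin: "finite (between f L)" by (rule finite_between[OF L])
    have f_in: "f \<in> between f L" using less.prems by (simp add: between_def)
    have finL: "finite (young L)" by (rule finite_young[OF L])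
    have less_n: "?n f < ?n g" if "g \<in> between f L" "g \<noteq> f" for g
    proof -
      have g: "f \<le> g" "g \<le> L" using that by (simp_all add: between_def)
      have "young f \<subseteq> young g" "young g \<subseteq> young L" "young f \<noteq> young g"
        using g that(2) by (auto simp: young_mono_iff young_inject)
      then have "young L - young g \<subset> young L - young f" by blast
      then have "card (young L - young g) < card (young L - young f)"
        using finL by (intro psubset_card_mono) auto
      then show ?thesis using size[OF g(2)] size[OF less.prems(2)] by linarith
    qed
    have IH: "F g * H L = H g * F L" if "g \<in> between f L - {f}" for g
    proof (rule less.hyps)
      have g: "antimono g" "g \<le> L" using that by (auto simp: between_def)
      show "antimono g" "g \<le> L" by fact+
      show "?n L - ?n g < ?n L - ?n f"
        using less_n[of g] that size[OF g(2)] by auto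
    qed
    have expand: "(r ^ ?n L - r ^ ?n f) * K f = (\<Sum>g\<in>between f L - {f}. r ^ ?n g * K g)"
      if "r ^ ?n L * K f = (\<Sum>g\<in>between f L. r ^ ?n g * K g)" for K
      using that unfolding sum.remove[OF fin f_in] by (simp add: algebra_simps)
    have "(r ^ ?n L - r ^ ?n f) * (F f * H L) = (\<Sum>g\<in>between f L - {f}. r ^ ?n g * F g) * H L"
      unfolding expand[of F, OF F[OF less.prems], symmetric] by (simp add: mult.assoc)
    also have "\<dots> = (\<Sum>g\<in>between f L - {f}. r ^ ?n g * H g) * F L"
      unfolding sum_distrib_right using IH by (intro sum.cong refl) (simp add: mult.assoc)
    also have "\<dots> = (r ^ ?n L - r ^ ?n f) * (H f * F L)"
      unfolding expand[of H, OF H[OF less.prems], symmetric] by (simp add: mult.assoc)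
    finally have eq: "(r ^ ?n L - r ^ ?n f) * (F f * H L) = (r ^ ?n L - r ^ ?n f) * (H f * F L)" .
    have "young f \<subset> young L" using False less.prems(2) young_mono_iff[of f L] young_inject[of f L] by blast
    then have "card (young L - young f) \<noteq> 0" using finL by auto
    then have "?n L \<noteq> ?n f" using size[OF less.prems(2)] by linarith
    then have "r ^ ?n L - r ^ ?n f \<noteq> 0" using r by auto
    then show ?thesis using eq by simp
  qed simp
qed

section \<open>The formula\<close>

text \<open>On a diagram the conditions on arbitrary pairs of cells follow from those on neighbours.\<close>
lemma is_ssyt_iff_low:
  assumes D: "diagram \<mu> = young f" "antimono f"
  shows "is_ssyt \<mu> T \<longleftrightarrow> T \<in> extensional (young f) \<and> (\<forall>u\<in>young f. low T u \<le> T u)"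
proof
  assume T: "is_ssyt \<mu> T"
  note dc = down_closed_young[OF D(2)]
  have "low T u \<le> T u" if u: "u \<in> young f" for u
  proof -
    obtain i j where ij: "u = (i, j)" by (cases u)
    note pos = down_closed_pos[OF dc u[unfolded ij]]
    have "T (i, j - 1) \<le> T (i, j)" if "1 < j"
    proof -
      have "(i, j - 1) \<in> young f" using that pos by (intro down_closedD[OF dc u[unfolded ij]]) simp_all
      moreover have "j - 1 < j" using that by simp
      ultimately show ?thesis using T u unfolding is_ssyt_def D(1) ij by blast
    qed
    moreover have "Suc (T (i - 1, j)) \<le> T (i, j)" if "1 < i"
    proof -
      have "(i - 1, j) \<in> young f" using that pos by (intro down_closedD[OF dc u[unfolded ij]]) simp_all
      moreover have "i - 1 < i" using that by simp
      ultimately have "T (i - 1, j) < T (i, j)" using T u unfolding is_ssyt_def D(1) ij by blast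
      then show ?thesis by simp
    qed
    moreover have "1 \<le> T (i, j)" using T u unfolding is_ssyt_def D(1) ij by blast
    ultimately show ?thesis unfolding ij low_def by simp
  qed
  then show "T \<in> extensional (young f) \<and> (\<forall>u\<in>young f. low T u \<le> T u)"
    using T unfolding is_ssyt_def D(1) by blast
next
  assume T: "T \<in> extensional (young f) \<and> (\<forall>u\<in>young f. low T u \<le> T u)"
  note dc = down_closed_young[OF D(2)]
  have row: "T (i, j) \<le> T (i, j')" if "j \<le> j'" "1 \<le> j" "(i, j') \<in> young f" for i j j'
    using that
  proof (induction j' rule: dec_induct)
    case (step n)
    note pos = down_closed_pos[OF dc step.prems(2)]
    have "(i, n) \<in> young f" using step pos by (intro down_closedD[OF dc step.prems(2)]) simp_all
    then have "T (i, j) \<le> T (i, n)" using step by simp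
    also have "\<dots> \<le> low T (i, Suc n)" using step by (simp add: low_def)
    also have "\<dots> \<le> T (i, Suc n)" using T step.prems(2) by blast
    finally show ?case .
  qed simp
  have col: "T (i, j) < T (Suc i', j)" if "i \<le> i'" "1 \<le> i" "(Suc i', j) \<in> young f" for i i' j
    using that
  proof (induction i' rule: dec_induct)
    case base
    have "T (i, j) < low T (Suc i, j)" using base by (simp add: low_def)
    also have "\<dots> \<le> T (Suc i, j)" using T base(2) by blast
    finally show ?case .
  next
    case (step n)
    note pos = down_closed_pos[OF dc step.prems(2)]
    have "(Suc n, j) \<in> young f" using step pos by (intro down_closedD[OF dc step.prems(2)]) simp_all
    then have "T (i, j) < T (Suc n, j)" using step by simp
    also have "\<dots> < low T (Suc (Suc n), j)" by (simp add: low_def)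
    also have "\<dots> \<le> T (Suc (Suc n), j)" using T step.prems(2) by blast
    finally show ?case .
  qed
  show "is_ssyt \<mu> T"
    unfolding is_ssyt_def D(1)
  proof (intro conjI ballI allI impI)
    show "T \<in> extensional (young f)" using T by simp
    show "1 \<le> T u" if "u \<in> young f" for u using T that low_pos[of T u] by (blast intro: order_trans)
    show "T (i, j) \<le> T (i, j')" if "(i, j) \<in> young f" "(i, j') \<in> young f" "j < j'" for i j j'
      using that down_closed_pos[OF dc that(1)] by (intro row) simp_all
    show "T (i, j) < T (i', j)" if "(i, j) \<in> young f" "(i', j) \<in> young f" "i < i'" for i i' j
      using that down_closed_pos[OF dc that(1)] col[of i "i' - 1" j] by simp
  qed
qed

text \<open>Replacing \<open>T u\<close> by \<open>k \<le> T u\<close> does not increase the bounds \<open>low\<close> at other cells and leaves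
  the bound at \<open>u\<close> as it is, so the condition at \<open>u\<close> is the only one that can fail.\<close>
lemma min_entry_eq_low:
  assumes D: "diagram \<mu> = young f" "antimono f" and T: "is_ssyt \<mu> T" and u: "u \<in> young f"
  shows "min_entry \<mu> T u = low T u"
proof -
  have low: "low T v \<le> T v" if "v \<in> young f" for v using T that unfolding is_ssyt_iff_low[OF D] by blast
  have ext: "T(u := k) \<in> extensional (young f)" for k
    using T u unfolding is_ssyt_iff_low[OF D] by (auto simp: extensional_def)
  have u1: "1 \<le> fst u" using u by (auto simp: young_def)
  have "k \<le> T u \<and> is_ssyt \<mu> (T(u := k)) \<longleftrightarrow> k \<le> T u \<and> low T u \<le> k" for k
  proof (cases "k \<le> T u")
    case True
    then have "low (T(u := k)) v \<le> low T v" for v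
      unfolding low_def by (intro max.mono) auto
    then have other: "low (T(u := k)) v \<le> T v" if "v \<in> young f" for v
      using low[OF that] order_trans by blast
    have "(\<forall>v\<in>young f. low (T(u := k)) v \<le> (T(u := k)) v) \<longleftrightarrow> low T u \<le> k"
    proof
      assume "\<forall>v\<in>young f. low (T(u := k)) v \<le> (T(u := k)) v"
      then have "low (T(u := k)) u \<le> (T(u := k)) u" using u by blast
      then show "low T u \<le> k" by (simp add: low_upd_self[OF u1])
    next
      assume k: "low T u \<le> k"
      show "\<forall>v\<in>young f. low (T(u := k)) v \<le> (T(u := k)) v"
      proof
        fix v assume "v \<in> young f"
        then show "low (T(u := k)) v \<le> (T(u := k)) v"
          using other[of v] k by (cases "v = u") (simp_all add: low_upd_self[OF u1])
      qed
    qed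
    then show ?thesis using True ext unfolding is_ssyt_iff_low[OF D] by blast
  qed simp
  then show ?thesis unfolding min_entry_def using low[OF u] by (intro Least_equality) auto
qed

lemma SSYT_eq_tableaux:
  assumes "diagram \<mu> = young f" "antimono f"
  shows "SSYT \<mu> d = tableaux (young f) d"
  unfolding SSYT_def tableaux_def is_ssyt_iff_low[OF assms] assms(1) by blast

lemma diagram_eq_young: "diagram lam = young (\<lambda>i. part lam (Suc i))"
proof -
  have "i \<le> length lam" if "1 \<le> j" "j \<le> part lam i" for i j
    using that by (simp add: part_def split: if_splits)
  then show ?thesis unfolding diagram_def young_def by auto
qed

lemma antimono_part:
  assumes "is_partition lam"
  shows "antimono (\<lambda>i. part lam (Suc i))"
  using assms unfolding is_partition_def antimono_iff_le_Suc
  by (auto simp: part_def sorted_wrt_iff_nth_less)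

lemma fls_X_inv_power_inject:
  assumes "(fls_X_inv :: 'b::field fls) ^ m = fls_X_inv ^ n"
  shows "m = n"
proof -
  have "fls_subdegree ((fls_X_inv :: 'b fls) ^ m) = fls_subdegree ((fls_X_inv :: 'b fls) ^ n)"
    by (simp only: assms)
  then show ?thesis by simp
qed

lemma fps_to_fls_sum:
  "fps_to_fls (\<Sum>i\<in>A. F i) = (\<Sum>i\<in>A. fps_to_fls (F i :: 'b::comm_ring_1 fps))"
  by (induction A rule: infinite_finite_induct) simp_all

lemma power_int_sum:
  fixes c :: "'b::field"
  assumes "c \<noteq> 0"
  shows "c powi (\<Sum>k\<in>A. e k) = (\<Prod>k\<in>A. c powi e k)"
  by (induction A rule: infinite_finite_induct) (simp_all add: power_int_add assms)

theorem theorem1p8: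
  fixes lam \<mu> :: "nat list" and d :: nat
  assumes "is_partition lam" and "is_partition \<mu>"
    and "d = length lam"
    and "diagram \<mu> \<subseteq> diagram lam"
  shows "fps_to_fls (rpp (diagram lam - diagram \<mu>)) / fps_to_fls (rpp (diagram lam)) =
    (\<Sum>T\<in>SSYT \<mu> d. fls_X powi p_stat lam \<mu> T *
       (\<Prod>u\<in>diagram \<mu>. 1 - fls_X powi weight lam u (T u)))"
proof -
  define L where "L = (\<lambda>i. part lam (Suc i))"
  define f where "f = (\<lambda>i. part \<mu> (Suc i))"
  define x :: "nat \<Rightarrow> rat fls" where "x = (\<lambda>k. fls_X ^ part lam (length lam + 1 - k))"
  define H :: "(nat \<Rightarrow> nat) \<Rightarrow> rat fls" where "H = (\<lambda>g. fps_to_fls (rpp (young L - young g)))"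
  interpret content_weights "fls_X :: rat fls" fls_X_inv x
    by unfold_locales (simp flip: fls_inverse_X)
  have dl: "diagram lam = young L" and dm: "diagram \<mu> = young f"
    by (simp_all add: L_def f_def diagram_eq_young)
  have aL: "antimono L" and af: "antimono f"
    using antimono_part assms(1,2) by (simp_all add: L_def f_def)
  have fL: "f \<le> L" using assms(4) by (simp add: dl dm young_mono_iff)
  have Ld: "\<forall>i\<ge>d. L i = 0" by (simp add: L_def part_def assms(3))
  have xL: "\<forall>k. 1 \<le> k \<and> k \<le> d \<longrightarrow> x k = fls_X ^ L (d - k)"
    by (auto simp: x_def L_def assms(3) Suc_diff_le)
  let ?r = "fls_X_inv :: rat fls"
  have invG: "?r ^ (\<Sum>i<d. L i) * ssyt_sum (young g) d = (\<Sum>h\<in>between g L. ?r ^ (\<Sum>i<d. h i) * ssyt_sum (young h) d)"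
    if "antimono g" "g \<le> L" for g
    using that Ld by (intro inversion[OF order_refl aL Ld xL]) (auto simp: le_fun_def, metis le_zero_eq)
  have rX: "?r ^ m * fls_X ^ m = 1" for m
    using qr by (simp add: power_mult_distrib[symmetric] mult.commute)
  have invH: "?r ^ (\<Sum>i<d. L i) * H g = (\<Sum>h\<in>between g L. ?r ^ (\<Sum>i<d. h i) * H h)"
    if g: "antimono g" "g \<le> L" for g
  proof -
    have "H g = (\<Sum>h\<in>between g L. fls_X ^ card (young L - young h) * H h)"
      unfolding H_def rpp_by_zero_set[OF aL Ld g]
      by (simp add: fps_to_fls_sum fls_times_fps_to_fls fps_to_fls_power)
    then have "?r ^ (\<Sum>i<d. L i) * H g = (\<Sum>h\<in>between g L. ?r ^ (\<Sum>i<d. L i) * (fls_X ^ card (young L - young h) * H h))"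
      by (simp add: sum_distrib_left)
    also have "\<dots> = (\<Sum>h\<in>between g L. ?r ^ (\<Sum>i<d. h i) * H h)"
    proof (rule sum.cong[OF refl])
      fix h assume "h \<in> between g L"
      then have "(\<Sum>i<d. L i) = card (young L - young h) + (\<Sum>i<d. h i)"
        using card_young_diff[OF Ld, of h] by (simp add: between_def)
      then have "?r ^ (\<Sum>i<d. L i) * (fls_X ^ card (young L - young h) * H h) =
          (?r ^ card (young L - young h) * fls_X ^ card (young L - young h)) * (?r ^ (\<Sum>i<d. h i) * H h)"
        by (simp add: power_add ac_simps)
      then show "?r ^ (\<Sum>i<d. L i) * (fls_X ^ card (young L - young h) * H h) = ?r ^ (\<Sum>i<d. h i) * H h"
        by (simp only: rX mult_1_left)
    qed
    finally show ?thesis .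
  qed
  have uniq: "ssyt_sum (young g) d * H L = H g * ssyt_sum (young L) d" if "antimono g" "g \<le> L" for g
    by (rule inversion_unique[OF Ld fls_X_inv_power_inject invG invH that])
  have HL: "H L = 1"
  proof -
    have "rpp {} = 1"
    proof (rule fps_ext)
      fix n
      have "{T. is_rpp {} T \<and> (\<Sum>u\<in>{}. T u) = n} = (if n = 0 then {\<lambda>_. undefined} else {})"
        by (auto simp: is_rpp_def)
      then show "rpp {} $ n = 1 $ n" by (simp add: rpp_def)
    qed
    then show ?thesis by (simp add: H_def)
  qed
  have y0: "young (\<lambda>_. 0) = {}" by (auto simp: young_def)
  have "ssyt_sum (young (\<lambda>_. 0)) d = 1" by (simp add: y0 ssyt_sum_def tableaux_def)
  moreover have "antimono (\<lambda>_::nat. 0::nat)" "(\<lambda>_. 0) \<le> L" by (simp_all add: antimono_def le_fun_def)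
  ultimately have norm: "H (\<lambda>_. 0) * ssyt_sum (young L) d = 1" using uniq[of "\<lambda>_. 0"] HL by simp
  have "ssyt_sum (young f) d = H f * ssyt_sum (young L) d" using uniq[OF af fL] HL by simp
  also have "\<dots> = H f / H (\<lambda>_. 0)"
    using norm by (metis inverse_unique divide_inverse)
  finally have quotient: "fps_to_fls (rpp (diagram lam - diagram \<mu>)) / fps_to_fls (rpp (diagram lam)) = ssyt_sum (young f) d"
    by (simp add: H_def y0 dl dm)
  have wt: "letter_wt u k = fls_X powi weight lam u k" if "u \<in> young f" for u k
  proof -
    have "(fls_X :: rat fls) powi weight lam u k = fls_X powi (int (part lam (length lam + 1 - k)) + int (fst u) + - int (snd u))"
      by (simp add: weight_def cell_content_def algebra_simps)
    also have "\<dots> = x k * fls_X ^ fst u * ?r ^ snd u"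
      by (subst power_int_add, simp, subst power_int_add)
        (simp_all add: x_def power_int_minus fls_inverse_X power_inverse[symmetric])
    finally show ?thesis by (simp add: letter_wt_def)
  qed
  show ?thesis
    unfolding quotient unfolding ssyt_sum_def SSYT_eq_tableaux[OF dm af, symmetric] dm
  proof (rule sum.cong[OF refl])
    fix T assume "T \<in> SSYT \<mu> d"
    then have T: "is_ssyt \<mu> T" by (simp add: SSYT_def)
    have "(fls_X :: rat fls) powi p_stat lam \<mu> T = (\<Prod>u\<in>young f. fls_X powi (\<Sum>k\<in>{min_entry \<mu> T u..<T u}. weight lam u k))"
      unfolding p_stat_def dm by (rule power_int_sum) simp
    also have "\<dots> = (\<Prod>u\<in>young f. \<Prod>k\<in>{low T u..<T u}. letter_wt u k)"
      by (intro prod.cong refl) (simp only: min_entry_eq_low[OF dm af T] power_int_sum[OF fls_X_nonzero] wt)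
    finally have p: "fls_X powi p_stat lam \<mu> T = (\<Prod>u\<in>young f. \<Prod>k\<in>{low T u..<T u}. letter_wt u k)" .
    have "(\<Prod>u\<in>young f. 1 - letter_wt u (T u)) = (\<Prod>u\<in>young f. 1 - fls_X powi weight lam u (T u))"
      by (intro prod.cong refl) (simp only: wt)
    then show "(\<Prod>u\<in>young f. (\<Prod>k\<in>{low T u..<T u}. letter_wt u k) * (1 - letter_wt u (T u))) =
        fls_X powi p_stat lam \<mu> T * (\<Prod>u\<in>young f. 1 - fls_X powi weight lam u (T u))"
      unfolding p prod.distrib by (rule arg_cong)
  qed
qed

end
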